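(* Let $\mathcal{C}$ be a braided nilpotent fusion category over $k$ such that its universal grading group $U(\mathcal{C})$ is cyclic. Then $\mathcal{C}$ has a faithful simple object, that is, there is a simple object $X$ of $\mathcal{C}$ such that the fusion subcategory generated by $X$ is $\mathcal{C}$.
   Context: $k$ is an algebraically closed field of characteristic zero. A fusion category over $k$ is a $k$-linear semisimple rigid tensor category with finitely many isomorphism classes of simple objects, finite-dimensional Hom spaces and simple unit object $\mathbf{1}$. A fusion subcategory is a full tensor subcategory stable under direct sums and subobjects. The adjoint subcategory $\mathcal{C}_{\mathrm{ad}}$ is the fusion subcategory generated by $X \otimes X^*$, $X$ running over the simple objects of $\mathcal{C}$. Set $\mathcal{C}^{(0)} = \mathcal{C}$ and $\mathcal{C}^{(n)} = (\mathcal{C}^{(n-1)})_{\mathrm{ad}}$ for $n \geq 1$; $\mathcal{C}$ is nilpotent if $\mathcal{C}^{(n)} = \mathrm{Vec}_k$ for some $n \ge 0$. A grading of $\mathcal{C}$ by a group $G$ is a decomposition $\mathcal{C} = \oplus_{g\in G}\mathcal{C}_g$ into full abelian subcategories with $\mathcal{C}_g^* = \mathcal{C}_{g^{-1}}$ and $\otimes$ mapping $\mathcal{C}_g\times \mathcal{C}_h$ to $\mathcal{C}_{gh}$; it is faithful if all $\mathcal{C}_g \neq 0$. Every fusion category has a canonical faithful grading, the universal grading, by a group $U(\mathcal{C})$ (the universal grading group), with trivial component $\mathcal{C}_e = \mathcal{C}_{\mathrm{ad}}$; every grading of $\mathcal{C}$ by a group $G$ is obtained from it through a unique group homomorphism $U(\mathcal{C})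 \to G$. *)

theory Defs
  imports "HOL-Algebra.Elementary_Groups" "HOL-Computational_Algebra.Polynomial"
begin

section \<open>Linear categories\<close>

record ('o, 'm, 'k) linear_cat =
  Obj :: "'o set"
  Arr :: "'m set"
  Dom :: "'m \<Rightarrow> 'o"
  Cod :: "'m \<Rightarrow> 'o"
  Id :: "'o \<Rightarrow> 'm"
  Comp :: "'m \<Rightarrow> 'm \<Rightarrow> 'm"  (infixr "\<cdot>\<index>" 70)
  Zero :: "'o \<Rightarrow> 'o \<Rightarrow> 'm"
  Add :: "'m \<Rightarrow> 'm \<Rightarrow> 'm"
  Smult :: "'k \<Rightarrow> 'm \<Rightarrow> 'm"

definition Hom :: "('o, 'm, 'k, 'z) linear_cat_scheme \<Rightarrow> 'o \<Rightarrow> 'o \<Rightarrow> 'm set" where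
  "Hom C X Y = {f \<in> Arr C. Dom C f = X \<and> Cod C f = Y}"

definition hom_group :: "('o, 'm, 'k, 'z) linear_cat_scheme \<Rightarrow> 'o \<Rightarrow> 'o \<Rightarrow> 'm monoid" where
  "hom_group C X Y = \<lparr>carrier = Hom C X Y, monoid.mult = Add C, one = Zero C X Y\<rparr>"

locale linear_category =
  fixes C :: "('o, 'm, 'k::field, 'z) linear_cat_scheme" (structure)
  assumes dom_obj: "f \<in> Arr C \<Longrightarrow> Dom C f \<in> Obj C"
    and cod_obj: "f \<in> Arr C \<Longrightarrow> Cod C f \<in> Obj C"
    and id_hom: "X \<in> Obj C \<Longrightarrow> Id C X \<in> Hom C X X"
    and comp_hom: "\<lbrakk>f \<in> Hom C X Y; g \<in> Hom C Y Z\<rbrakk> \<Longrightarrow> g \<cdot> f \<in> Hom C X Z"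
    and comp_id_right: "f \<in> Hom C X Y \<Longrightarrow> f \<cdot> Id C X = f"
    and comp_id_left: "f \<in> Hom C X Y \<Longrightarrow> Id C Y \<cdot> f = f"
    and comp_assoc: "\<lbrakk>f \<in> Hom C W X; g \<in> Hom C X Y; h \<in> Hom C Y Z\<rbrakk>
      \<Longrightarrow> (h \<cdot> g) \<cdot> f = h \<cdot> (g \<cdot> f)"
    and hom_comm_group: "\<lbrakk>X \<in> Obj C; Y \<in> Obj C\<rbrakk> \<Longrightarrow> comm_group (hom_group C X Y)"
    and smult_hom: "f \<in> Hom C X Y \<Longrightarrow> Smult C a f \<in> Hom C X Y"
    and smult_one: "f \<in> Hom C X Y \<Longrightarrow> Smult C 1 f = f"
    and smult_smult: "f \<in> Hom C X Y \<Longrightarrow> Smult C a (Smult C b f) = Smult C (a * b) f"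
    and smult_add_left: "f \<in> Hom C X Y \<Longrightarrow>
      Smult C (a + b) f = Add C (Smult C a f) (Smult C b f)"
    and smult_add_right: "\<lbrakk>f \<in> Hom C X Y; g \<in> Hom C X Y\<rbrakk> \<Longrightarrow>
      Smult C a (Add C f g) = Add C (Smult C a f) (Smult C a g)"
    and comp_add_left: "\<lbrakk>f \<in> Hom C X Y; g \<in> Hom C Y Z; h \<in> Hom C Y Z\<rbrakk> \<Longrightarrow>
      Add C g h \<cdot> f = Add C (g \<cdot> f) (h \<cdot> f)"
    and comp_add_right: "\<lbrakk>f \<in> Hom C X Y; g \<in> Hom C X Y; h \<in> Hom C Y Z\<rbrakk> \<Longrightarrow>
      h \<cdot> Add C f g = Add C (h \<cdot> f) (h \<cdot> g)"
    and comp_smult_left: "\<lbrakk>f \<in> Hom C X Y; g \<in> Hom C Y Z\<rbrakk> \<Longrightarrow>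
      Smult C a g \<cdot> f = Smult C a (g \<cdot> f)"
    and comp_smult_right: "\<lbrakk>f \<in> Hom C X Y; g \<in> Hom C Y Z\<rbrakk> \<Longrightarrow>
      g \<cdot> Smult C a f = Smult C a (g \<cdot> f)"

definition inverse_arrows :: "('o, 'm, 'k, 'z) linear_cat_scheme \<Rightarrow> 'm \<Rightarrow> 'm \<Rightarrow> bool" where
  "inverse_arrows C f g \<longleftrightarrow> f \<in> Arr C \<and> g \<in> Hom C (Cod C f) (Dom C f) \<and>
     g \<cdot>\<^bsub>C\<^esub> f = Id C (Dom C f) \<and> f \<cdot>\<^bsub>C\<^esub> g = Id C (Cod C f)"

definition is_iso :: "('o, 'm, 'k, 'z) linear_cat_scheme \<Rightarrow> 'm \<Rightarrow> bool" where
  "is_iso C f \<longleftrightarrow> (\<exists>g. inverse_arrows C f g)"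

definition inv_arr :: "('o, 'm, 'k, 'z) linear_cat_scheme \<Rightarrow> 'm \<Rightarrow> 'm" where
  "inv_arr C f = (THE g. inverse_arrows C f g)"

definition isomorphic :: "('o, 'm, 'k, 'z) linear_cat_scheme \<Rightarrow> 'o \<Rightarrow> 'o \<Rightarrow> bool" where
  "isomorphic C X Y \<longleftrightarrow> (\<exists>f \<in> Hom C X Y. is_iso C f)"

definition is_mono :: "('o, 'm, 'k, 'z) linear_cat_scheme \<Rightarrow> 'm \<Rightarrow> bool" where
  "is_mono C f \<longleftrightarrow> f \<in> Arr C \<and>
     (\<forall>W. \<forall>g \<in> Hom C W (Dom C f). \<forall>h \<in> Hom C W (Dom C f). f \<cdot>\<^bsub>C\<^esub> g = f \<cdot>\<^bsub>C\<^esub> h \<longrightarrow> g = h)"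

definition is_epi :: "('o, 'm, 'k, 'z) linear_cat_scheme \<Rightarrow> 'm \<Rightarrow> bool" where
  "is_epi C f \<longleftrightarrow> f \<in> Arr C \<and>
     (\<forall>W. \<forall>g \<in> Hom C (Cod C f) W. \<forall>h \<in> Hom C (Cod C f) W. g \<cdot>\<^bsub>C\<^esub> f = h \<cdot>\<^bsub>C\<^esub> f \<longrightarrow> g = h)"

definition zero_object :: "('o, 'm, 'k, 'z) linear_cat_scheme \<Rightarrow> 'o \<Rightarrow> bool" where
  "zero_object C X \<longleftrightarrow> X \<in> Obj C \<and>
     (\<forall>Y \<in> Obj C. (\<exists>!f. f \<in> Hom C X Y) \<and> (\<exists>!f. f \<in> Hom C Y X))"

definition biproduct :: "('o, 'm, 'k, 'z) linear_cat_scheme \<Rightarrow> 'o \<Rightarrow> 'o \<Rightarrow> 'o \<Rightarrow> bool" where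
  "biproduct C Z X Y \<longleftrightarrow>
     (\<exists>i \<in> Hom C X Z. \<exists>j \<in> Hom C Y Z. \<exists>p \<in> Hom C Z X. \<exists>q \<in> Hom C Z Y.
        p \<cdot>\<^bsub>C\<^esub> i = Id C X \<and> q \<cdot>\<^bsub>C\<^esub> j = Id C Y \<and>
        q \<cdot>\<^bsub>C\<^esub> i = Zero C X Y \<and> p \<cdot>\<^bsub>C\<^esub> j = Zero C Y X \<and>
        Add C (i \<cdot>\<^bsub>C\<^esub> p) (j \<cdot>\<^bsub>C\<^esub> q) = Id C Z)"

inductive direct_sum :: "('o, 'm, 'k, 'z) linear_cat_scheme \<Rightarrow> 'o \<Rightarrow> 'o list \<Rightarrow> bool"
  for C where
  Nil: "zero_object C Z \<Longrightarrow> direct_sum C Z []"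
| Cons: "\<lbrakk>direct_sum C Z' Xs; biproduct C Z X Z'\<rbrakk> \<Longrightarrow> direct_sum C Z (X # Xs)"

definition is_kernel :: "('o, 'm, 'k, 'z) linear_cat_scheme \<Rightarrow> 'm \<Rightarrow> 'm \<Rightarrow> bool" where
  "is_kernel C f k \<longleftrightarrow> f \<in> Arr C \<and> k \<in> Arr C \<and> Cod C k = Dom C f \<and>
     f \<cdot>\<^bsub>C\<^esub> k = Zero C (Dom C k) (Cod C f) \<and>
     (\<forall>W. \<forall>g \<in> Hom C W (Dom C f). f \<cdot>\<^bsub>C\<^esub> g = Zero C W (Cod C f) \<longrightarrow>
        (\<exists>!h. h \<in> Hom C W (Dom C k) \<and> k \<cdot>\<^bsub>C\<^esub> h = g))"

definition is_cokernel :: "('o, 'm, 'k, 'z) linear_cat_scheme \<Rightarrow> 'm \<Rightarrow> 'm \<Rightarrow> bool" where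
  "is_cokernel C f q \<longleftrightarrow> f \<in> Arr C \<and> q \<in> Arr C \<and> Dom C q = Cod C f \<and>
     q \<cdot>\<^bsub>C\<^esub> f = Zero C (Dom C f) (Cod C q) \<and>
     (\<forall>W. \<forall>g \<in> Hom C (Cod C f) W. g \<cdot>\<^bsub>C\<^esub> f = Zero C (Dom C f) W \<longrightarrow>
        (\<exists>!h. h \<in> Hom C (Cod C q) W \<and> h \<cdot>\<^bsub>C\<^esub> q = g))"

locale linear_abelian_category = linear_category C
  for C :: "('o, 'm, 'k::field, 'z) linear_cat_scheme" (structure) +
  assumes ex_zero_object: "\<exists>Z. zero_object C Z"
    and ex_biproduct: "\<lbrakk>X \<in> Obj C; Y \<in> Obj C\<rbrakk> \<Longrightarrow> \<exists>Z. biproduct C Z X Y"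
    and ex_kernel: "f \<in> Arr C \<Longrightarrow> \<exists>k. is_kernel C f k"
    and ex_cokernel: "f \<in> Arr C \<Longrightarrow> \<exists>q. is_cokernel C f q"
    and mono_is_kernel: "is_mono C f \<Longrightarrow> \<exists>g. is_kernel C g f"
    and epi_is_cokernel: "is_epi C f \<Longrightarrow> \<exists>g. is_cokernel C g f"

definition simple_object :: "('o, 'm, 'k, 'z) linear_cat_scheme \<Rightarrow> 'o \<Rightarrow> bool" where
  "simple_object C X \<longleftrightarrow> X \<in> Obj C \<and> \<not> zero_object C X \<and>
     (\<forall>f. is_mono C f \<and> Cod C f = X \<longrightarrow> zero_object C (Dom C f) \<or> is_iso C f)"

definition linear_combination ::
  "('o, 'm, 'k, 'z) linear_cat_scheme \<Rightarrow> 'o \<Rightarrow> 'o \<Rightarrow> 'k list \<Rightarrow> 'm list \<Rightarrow> 'm" where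
  "linear_combination C X Y cs fs =
     foldr (\<lambda>(c, f) g. Add C (Smult C c f) g) (zip cs fs) (Zero C X Y)"

definition finite_dim_hom :: "('o, 'm, 'k, 'z) linear_cat_scheme \<Rightarrow> 'o \<Rightarrow> 'o \<Rightarrow> bool" where
  "finite_dim_hom C X Y \<longleftrightarrow> (\<exists>fs. set fs \<subseteq> Hom C X Y \<and>
     (\<forall>f \<in> Hom C X Y. \<exists>cs. length cs = length fs \<and> f = linear_combination C X Y cs fs))"


section \<open>Fusion categories\<close>

record ('o, 'm, 'k) tensor_cat = "('o, 'm, 'k) linear_cat" +
  Tensor :: "'o \<Rightarrow> 'o \<Rightarrow> 'o"  (infixr "\<boxtimes>\<index>" 75)
  TensorArr :: "'m \<Rightarrow> 'm \<Rightarrow> 'm"  (infixr "\<star>\<index>" 75)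
  Unit :: "'o"
  Assoc :: "'o \<Rightarrow> 'o \<Rightarrow> 'o \<Rightarrow> 'm"
  LUnit :: "'o \<Rightarrow> 'm"
  RUnit :: "'o \<Rightarrow> 'm"

locale tensor_category = linear_abelian_category C
  for C :: "('o, 'm, 'k::field, 'z) tensor_cat_scheme" (structure) +
  assumes tensor_obj: "\<lbrakk>X \<in> Obj C; Y \<in> Obj C\<rbrakk> \<Longrightarrow> X \<boxtimes> Y \<in> Obj C"
    and unit_obj: "Unit C \<in> Obj C"
    and tensor_hom: "\<lbrakk>f \<in> Hom C X Y; g \<in> Hom C X' Y'\<rbrakk> \<Longrightarrow> f \<star> g \<in> Hom C (X \<boxtimes> X') (Y \<boxtimes> Y')"
    and tensor_id: "\<lbrakk>X \<in> Obj C; Y \<in> Obj C\<rbrakk> \<Longrightarrow> Id C X \<star> Id C Y = Id C (X \<boxtimes> Y)"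
    and tensor_comp: "\<lbrakk>f \<in> Hom C X Y; g \<in> Hom C Y Z; f' \<in> Hom C X' Y'; g' \<in> Hom C Y' Z'\<rbrakk>
      \<Longrightarrow> (g \<cdot> f) \<star> (g' \<cdot> f') = (g \<star> g') \<cdot> (f \<star> f')"
    and tensor_add_left: "\<lbrakk>f \<in> Hom C X Y; g \<in> Hom C X Y; h \<in> Hom C X' Y'\<rbrakk>
      \<Longrightarrow> Add C f g \<star> h = Add C (f \<star> h) (g \<star> h)"
    and tensor_add_right: "\<lbrakk>f \<in> Hom C X Y; g \<in> Hom C X Y; h \<in> Hom C X' Y'\<rbrakk>
      \<Longrightarrow> h \<star> Add C f g = Add C (h \<star> f) (h \<star> g)"
    and tensor_smult_left: "\<lbrakk>f \<in> Hom C X Y; h \<in> Hom C X' Y'\<rbrakk>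
      \<Longrightarrow> Smult C a f \<star> h = Smult C a (f \<star> h)"
    and tensor_smult_right: "\<lbrakk>f \<in> Hom C X Y; h \<in> Hom C X' Y'\<rbrakk>
      \<Longrightarrow> f \<star> Smult C a h = Smult C a (f \<star> h)"
    and assoc_hom: "\<lbrakk>X \<in> Obj C; Y \<in> Obj C; Z \<in> Obj C\<rbrakk>
      \<Longrightarrow> Assoc C X Y Z \<in> Hom C ((X \<boxtimes> Y) \<boxtimes> Z) (X \<boxtimes> (Y \<boxtimes> Z))"
    and assoc_iso: "\<lbrakk>X \<in> Obj C; Y \<in> Obj C; Z \<in> Obj C\<rbrakk> \<Longrightarrow> is_iso C (Assoc C X Y Z)"
    and assoc_natural: "\<lbrakk>f \<in> Hom C X X'; g \<in> Hom C Y Y'; h \<in> Hom C Z Z'\<rbrakk>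
      \<Longrightarrow> Assoc C X' Y' Z' \<cdot> ((f \<star> g) \<star> h) = (f \<star> (g \<star> h)) \<cdot> Assoc C X Y Z"
    and lunit_hom: "X \<in> Obj C \<Longrightarrow> LUnit C X \<in> Hom C (Unit C \<boxtimes> X) X"
    and lunit_iso: "X \<in> Obj C \<Longrightarrow> is_iso C (LUnit C X)"
    and lunit_natural: "f \<in> Hom C X Y \<Longrightarrow> LUnit C Y \<cdot> (Id C (Unit C) \<star> f) = f \<cdot> LUnit C X"
    and runit_hom: "X \<in> Obj C \<Longrightarrow> RUnit C X \<in> Hom C (X \<boxtimes> Unit C) X"
    and runit_iso: "X \<in> Obj C \<Longrightarrow> is_iso C (RUnit C X)"
    and runit_natural: "f \<in> Hom C X Y \<Longrightarrow> RUnit C Y \<cdot> (f \<star> Id C (Unit C)) = f \<cdot> RUnit C X"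
    and pentagon: "\<lbrakk>W \<in> Obj C; X \<in> Obj C; Y \<in> Obj C; Z \<in> Obj C\<rbrakk> \<Longrightarrow>
      Assoc C W X (Y \<boxtimes> Z) \<cdot> Assoc C (W \<boxtimes> X) Y Z =
      (Id C W \<star> Assoc C X Y Z) \<cdot> Assoc C W (X \<boxtimes> Y) Z \<cdot> (Assoc C W X Y \<star> Id C Z)"
    and triangle: "\<lbrakk>X \<in> Obj C; Y \<in> Obj C\<rbrakk> \<Longrightarrow>
      (Id C X \<star> LUnit C Y) \<cdot> Assoc C X (Unit C) Y = RUnit C X \<star> Id C Y"

text \<open>
  \<open>left_dual C X Y\<close> says that \<open>Y\<close> is a model of the dual \<open>X\<^sup>*\<close>, with evaluation
  \<open>X\<^sup>* \<otimes> X \<rightarrow> \<one>\<close> and coevaluation \<open>\<one> \<rightarrow> X \<otimes> X\<^sup>*\<close>.  Duals are unique up to isomorphism, and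
  whatever is built from them below is closed under isomorphism, so no dual is chosen.
\<close>
definition left_dual :: "('o, 'm, 'k, 'z) tensor_cat_scheme \<Rightarrow> 'o \<Rightarrow> 'o \<Rightarrow> bool" where
  "left_dual C X Y \<longleftrightarrow> X \<in> Obj C \<and> Y \<in> Obj C \<and>
     (\<exists>ev \<in> Hom C (Y \<boxtimes>\<^bsub>C\<^esub> X) (Unit C). \<exists>coev \<in> Hom C (Unit C) (X \<boxtimes>\<^bsub>C\<^esub> Y).
        RUnit C X \<cdot>\<^bsub>C\<^esub> (Id C X \<star>\<^bsub>C\<^esub> ev) \<cdot>\<^bsub>C\<^esub> Assoc C X Y X \<cdot>\<^bsub>C\<^esub> (coev \<star>\<^bsub>C\<^esub> Id C X) = LUnit C X \<and>
        LUnit C Y \<cdot>\<^bsub>C\<^esub> (ev \<star>\<^bsub>C\<^esub> Id C Y) \<cdot>\<^bsub>C\<^esub> inv_arr C (Assoc C Y X Y) \<cdot>\<^bsub>C\<^esub> (Id C Y \<star>\<^bsub>C\<^esub> coev) = RUnit C Y)"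

locale fusion_category = tensor_category C
  for C :: "('o, 'm, 'k::{alg_closed_field, field_char_0}, 'z) tensor_cat_scheme" (structure) +
  assumes ex_left_dual: "X \<in> Obj C \<Longrightarrow> \<exists>Y. left_dual C X Y"
    and ex_right_dual: "X \<in> Obj C \<Longrightarrow> \<exists>Y. left_dual C Y X"
    and semisimple: "X \<in> Obj C \<Longrightarrow> \<exists>Ss. (\<forall>S \<in> set Ss. simple_object C S) \<and> direct_sum C X Ss"
    and finitely_many_simples:
      "\<exists>F. finite F \<and> (\<forall>X. simple_object C X \<longrightarrow> (\<exists>Y \<in> F. isomorphic C X Y))"
    and finite_dim: "\<lbrakk>X \<in> Obj C; Y \<in> Obj C\<rbrakk> \<Longrightarrow> finite_dim_hom C X Y"
    and unit_simple: "simple_object C (Unit C)"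

record ('o, 'm, 'k) braided_cat = "('o, 'm, 'k) tensor_cat" +
  Braid :: "'o \<Rightarrow> 'o \<Rightarrow> 'm"

locale braided_fusion_category = fusion_category C
  for C :: "('o, 'm, 'k::{alg_closed_field, field_char_0}, 'z) braided_cat_scheme" (structure) +
  assumes braid_hom: "\<lbrakk>X \<in> Obj C; Y \<in> Obj C\<rbrakk> \<Longrightarrow> Braid C X Y \<in> Hom C (X \<boxtimes> Y) (Y \<boxtimes> X)"
    and braid_iso: "\<lbrakk>X \<in> Obj C; Y \<in> Obj C\<rbrakk> \<Longrightarrow> is_iso C (Braid C X Y)"
    and braid_natural: "\<lbrakk>f \<in> Hom C X X'; g \<in> Hom C Y Y'\<rbrakk>
      \<Longrightarrow> Braid C X' Y' \<cdot> (f \<star> g) = (g \<star> f) \<cdot> Braid C X Y"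
    and hexagon1: "\<lbrakk>X \<in> Obj C; Y \<in> Obj C; Z \<in> Obj C\<rbrakk> \<Longrightarrow>
      Assoc C Y Z X \<cdot> Braid C X (Y \<boxtimes> Z) \<cdot> Assoc C X Y Z =
      (Id C Y \<star> Braid C X Z) \<cdot> Assoc C Y X Z \<cdot> (Braid C X Y \<star> Id C Z)"
    and hexagon2: "\<lbrakk>X \<in> Obj C; Y \<in> Obj C; Z \<in> Obj C\<rbrakk> \<Longrightarrow>
      inv_arr C (Assoc C Z X Y) \<cdot> Braid C (X \<boxtimes> Y) Z \<cdot> inv_arr C (Assoc C X Y Z) =
      (Braid C X Z \<star> Id C Y) \<cdot> inv_arr C (Assoc C X Z Y) \<cdot> (Id C X \<star> Braid C Y Z)"


section \<open>Fusion subcategories and nilpotency\<close>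

text \<open>Full subcategories are identified with their sets of objects.\<close>

definition fusion_subcategory :: "('o, 'm, 'k, 'z) tensor_cat_scheme \<Rightarrow> 'o set \<Rightarrow> bool" where
  "fusion_subcategory C D \<longleftrightarrow> D \<subseteq> Obj C \<and> Unit C \<in> D \<and>
     (\<forall>X \<in> D. \<forall>Y \<in> D. X \<boxtimes>\<^bsub>C\<^esub> Y \<in> D) \<and>
     (\<forall>X \<in> D. \<forall>Y \<in> D. \<forall>Z. biproduct C Z X Y \<longrightarrow> Z \<in> D) \<and>
     (\<forall>f. is_mono C f \<and> Cod C f \<in> D \<longrightarrow> Dom C f \<in> D)"

definition generated_fusion_subcategory ::
  "('o, 'm, 'k, 'z) tensor_cat_scheme \<Rightarrow> 'o set \<Rightarrow> 'o set" where
  "generated_fusion_subcategory C S = \<Inter>{D. fusion_subcategory C D \<and> S \<subseteq> D}"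

text \<open>
  \<open>adjoint_subcategory C D\<close> is the adjoint subcategory of the fusion subcategory \<open>D\<close> of \<open>C\<close>.
  As \<open>D\<close> is full and closed under subobjects, simple objects, duals and generated fusion
  subcategories may be computed in \<open>C\<close>.
\<close>
definition adjoint_subcategory :: "('o, 'm, 'k, 'z) tensor_cat_scheme \<Rightarrow> 'o set \<Rightarrow> 'o set" where
  "adjoint_subcategory C D = generated_fusion_subcategory C
     {X \<boxtimes>\<^bsub>C\<^esub> Y |X Y. X \<in> D \<and> simple_object C X \<and> left_dual C X Y}"

primrec iterated_adjoint :: "('o, 'm, 'k, 'z) tensor_cat_scheme \<Rightarrow> nat \<Rightarrow> 'o set" where
  "iterated_adjoint C 0 = Obj C"
| "iterated_adjoint C (Suc n) = adjoint_subcategory C (iterated_adjoint C n)"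

text \<open>The copy of the category of finite-dimensional vector spaces generated by the unit.\<close>
definition vec_subcategory :: "('o, 'm, 'k, 'z) tensor_cat_scheme \<Rightarrow> 'o set" where
  "vec_subcategory C = {X. \<exists>n. direct_sum C X (replicate n (Unit C))}"

definition nilpotent_category :: "('o, 'm, 'k, 'z) tensor_cat_scheme \<Rightarrow> bool" where
  "nilpotent_category C \<longleftrightarrow> (\<exists>n. iterated_adjoint C n = vec_subcategory C)"


section \<open>Gradings\<close>

definition full_abelian_subcategory :: "('o, 'm, 'k, 'z) linear_cat_scheme \<Rightarrow> 'o set \<Rightarrow> bool" where
  "full_abelian_subcategory C D \<longleftrightarrow> D \<subseteq> Obj C \<and>
     (\<forall>X \<in> D. \<forall>Y. isomorphic C X Y \<longrightarrow> Y \<in> D) \<and>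
     (\<exists>Z \<in> D. zero_object C Z) \<and>
     (\<forall>X \<in> D. \<forall>Y \<in> D. \<forall>Z. biproduct C Z X Y \<longrightarrow> Z \<in> D) \<and>
     (\<forall>f k. Dom C f \<in> D \<and> Cod C f \<in> D \<and> is_kernel C f k \<longrightarrow> Dom C k \<in> D) \<and>
     (\<forall>f q. Dom C f \<in> D \<and> Cod C f \<in> D \<and> is_cokernel C f q \<longrightarrow> Cod C q \<in> D)"

text \<open>The objects that are finite direct sums of objects of the \<open>E g\<close> with \<open>g \<in> I\<close>.\<close>
definition component_sum ::
  "('o, 'm, 'k, 'z) linear_cat_scheme \<Rightarrow> ('g \<Rightarrow> 'o set) \<Rightarrow> 'g set \<Rightarrow> 'o set" where
  "component_sum C E I = {X. \<exists>gs Xs. distinct gs \<and> set gs \<subseteq> I \<and>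
     list_all2 (\<lambda>g Y. Y \<in> E g) gs Xs \<and> direct_sum C X Xs}"

definition grading ::
  "('o, 'm, 'k, 'z) tensor_cat_scheme \<Rightarrow> ('g, 'b) monoid_scheme \<Rightarrow> ('g \<Rightarrow> 'o set) \<Rightarrow> bool" where
  "grading C G E \<longleftrightarrow> group G \<and>
     (\<forall>g \<in> carrier G. full_abelian_subcategory C (E g)) \<and>
     component_sum C E (carrier G) = Obj C \<and>
     (\<forall>g \<in> carrier G. \<forall>h \<in> carrier G. g \<noteq> h \<longrightarrow>
        (\<forall>X \<in> E g. \<forall>Y \<in> E h. Hom C X Y = {Zero C X Y})) \<and>
     (\<forall>g \<in> carrier G. {Y. \<exists>X \<in> E g. left_dual C X Y} = E (inv\<^bsub>G\<^esub> g)) \<and>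
     (\<forall>g \<in> carrier G. \<forall>h \<in> carrier G. \<forall>X \<in> E g. \<forall>Y \<in> E h. X \<boxtimes>\<^bsub>C\<^esub> Y \<in> E (g \<otimes>\<^bsub>G\<^esub> h))"

definition faithful_grading ::
  "('o, 'm, 'k, 'z) tensor_cat_scheme \<Rightarrow> ('g, 'b) monoid_scheme \<Rightarrow> ('g \<Rightarrow> 'o set) \<Rightarrow> bool" where
  "faithful_grading C G E \<longleftrightarrow> grading C G E \<and>
     (\<forall>g \<in> carrier G. \<exists>X \<in> E g. \<not> zero_object C X)"

text \<open>
  \<open>universal_grading C U E\<close>: \<open>E\<close> is the universal grading of \<open>C\<close>, with universal grading group \<open>U\<close>
  (this determines \<open>U\<close> up to isomorphism).  A grading \<open>D\<close> by \<open>G\<close> is obtained from \<open>E\<close> through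
  \<open>\<phi>\<close> if \<open>D g\<close> is the sum of the \<open>E u\<close> with \<open>\<phi> u = g\<close>; \<open>extensional\<close> makes uniqueness of
  \<open>\<phi>\<close> mean uniqueness on the carrier.  HOL cannot quantify over groups of all types; letting
  \<open>G\<close> range over the groups carried by sets of natural numbers loses nothing, since the nonzero
  components of a grading of a fusion category have finitely many degrees, which therefore
  generate a countable (in fact finite) subgroup.
\<close>
definition universal_grading ::
  "('o, 'm, 'k, 'z) tensor_cat_scheme \<Rightarrow> ('u, 'b) monoid_scheme \<Rightarrow> ('u \<Rightarrow> 'o set) \<Rightarrow> bool" where
  "universal_grading C U E \<longleftrightarrow> faithful_grading C U E \<and>
     E \<one>\<^bsub>U\<^esub> = adjoint_subcategory C (Obj C) \<and>
     (\<forall>(G :: nat monoid) D. grading C G D \<longrightarrow>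
        (\<exists>!\<phi>. \<phi> \<in> hom U G \<inter> extensional (carrier U) \<and>
           (\<forall>g \<in> carrier G. D g = component_sum C E {u \<in> carrier U. \<phi> u = g})))"

end

theory Submission
  imports Defs
begin

text \<open>
  Let \<open>X\<close> be any simple object in the component of degree \<open>g\<close>, where \<open>g\<close> generates the universal
  grading group, and let \<open>D\<close> be the fusion subcategory that \<open>X\<close> generates.  Once \<open>D\<close> is known to
  be closed under duals, it meets every component, so that every simple object \<open>Y\<close> of \<open>C\<close> occurs
  in some \<open>X \<otimes> Z\<close> with \<open>X\<close> in \<open>D\<close> and \<open>Z\<close> in \<open>C\<^sub>a\<^sub>d\<close>.  Since the tensor product
  is commutative up to isomorphism, \<open>Y \<otimes> Y\<^sup>*\<close> then lies in
  \<open>(X \<otimes> X\<^sup>*) \<otimes> (Z \<otimes> Z\<^sup>*)\<close>, that is, in the product of \<open>D\<close> with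
  \<open>(C\<^sub>a\<^sub>d)\<^sub>a\<^sub>d\<close>.  These objects generate \<open>C\<^sub>a\<^sub>d\<close>, so the argument can be iterated: every
  \<open>C\<^sup>(\<^sup>n\<^sup>)\<close> is contained in the product of \<open>D\<close> with \<open>C\<^sup>(\<^sup>n\<^sup>+\<^sup>1\<^sup>)\<close>.  By
  nilpotency the factor on the right is eventually trivial, and hence \<open>D = C\<close>.

  Closure of \<open>D\<close> under duals also follows from nilpotency.  Let
  \<open>Y\<close> be simple in \<open>C\<^sup>(\<^sup>n\<^sup>)\<close>.  In a sequence of simple objects, each a constituent of the
  tensor product of \<open>Y\<close> with the preceding one, some isomorphism class recurs; so a constituent \<open>S\<close>
  of a power of \<open>Y\<close> occurs in \<open>Q \<otimes> S\<close> for a constituent \<open>Q\<close> of another power.  Then \<open>Q\<close> occurs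
  in \<open>S \<otimes> S\<^sup>*\<close> and therefore lies in \<open>C\<^sup>(\<^sup>n\<^sup>+\<^sup>1\<^sup>)\<close>.  Descending in this way, some
  positive power of \<open>Y\<close> contains the unit object, and then the preceding power contains \<open>Y\<^sup>*\<close>.

  All of this uses only which simple objects occur in which tensor products, not their
  multiplicities.  Under this relation the simple objects form a finite commutative hypergroup, to
  which the combinatorial argument is confined (\<open>closed_supplement_of_adjoint\<close>).  The passage to
  the hypergroup rests on Frobenius reciprocity (\<open>left_dual_transpose\<close> and
  \<open>left_dual_untranspose\<close>) and semisimplicity (\<open>linked_simple_constituent\<close> and
  \<open>linked_via_simple\<close>).
\<close>

section \<open>Nilpotent commutative hypergroups\<close>

text \<open>
  The hypergroup of a braided fusion category has the simple objects as elements, and \<open>a \<odot> b\<close> consists of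
  the constituents of \<open>a \<otimes> b\<close>.  The transposition axiom is that of join spaces; it yields the
  uniqueness of inverses and the reversibility law, which are the usual axioms of canonical
  hypergroups.
\<close>
locale finite_canonical_hypergroup =
  fixes H :: "'a set"
    and mult :: "'a \<Rightarrow> 'a \<Rightarrow> 'a set"  (infixl "\<odot>" 70)
    and e :: 'a
  assumes finite_carrier: "finite H"
    and identity_closed: "e \<in> H"
    and mult_closed: "\<lbrakk>a \<in> H; b \<in> H; c \<in> a \<odot> b\<rbrakk> \<Longrightarrow> c \<in> H"
    and mult_commute: "\<lbrakk>a \<in> H; b \<in> H\<rbrakk> \<Longrightarrow> a \<odot> b = b \<odot> a"
    and mult_assoc: "\<lbrakk>a \<in> H; b \<in> H; c \<in> H\<rbrakk> \<Longrightarrow>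
      (\<Union>x \<in> a \<odot> b. x \<odot> c) = (\<Union>y \<in> b \<odot> c. a \<odot> y)"
    and mult_identity: "a \<in> H \<Longrightarrow> e \<odot> a = {a}"
    and inverse_exists: "a \<in> H \<Longrightarrow> \<exists>b \<in> H. e \<in> a \<odot> b"
    and transposition: "\<lbrakk>x \<in> H; a \<in> H; b \<in> H; c \<in> H; d \<in> H; a \<in> x \<odot> b; c \<in> x \<odot> d\<rbrakk> \<Longrightarrow>
      (a \<odot> d) \<inter> (c \<odot> b) \<noteq> {}"
begin

text \<open>
  This mirrors the closure properties that define a fusion subcategory; closure under inverses is a
  consequence of nilpotency (\<open>closed_subset_inverse\<close>).
\<close>
definition closed_subset :: "'a set \<Rightarrow> bool" where
  "closed_subset K \<longleftrightarrow> K \<subseteq> H \<and> e \<in> K \<and> (\<forall>a \<in> K. \<forall>b \<in> K. a \<odot> b \<subseteq> K)"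

text \<open>
  By reversibility \<open>a \<in> c \<odot> a\<close> holds exactly if \<open>c\<close> lies in the product of \<open>a\<close> with its
  inverse; so these are the analogues of the constituents of \<open>X \<otimes> X\<^sup>*\<close>.
\<close>
definition adjoint_generators :: "'a set \<Rightarrow> 'a set" where
  "adjoint_generators K = {c \<in> H. \<exists>a \<in> K. a \<in> c \<odot> a}"

definition adjoint :: "'a set \<Rightarrow> 'a set" where
  "adjoint K = \<Inter>{L. closed_subset L \<and> adjoint_generators K \<subseteq> L}"

definition adjoint_series :: "nat \<Rightarrow> 'a set" where
  "adjoint_series n = (adjoint ^^ n) H"

lemma adjoint_series_0: "adjoint_series 0 = H"
  and adjoint_series_Suc: "adjoint_series (Suc n) = adjoint (adjoint_series n)"
  by (simp_all add: adjoint_series_def)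

lemma assoc_right:
  assumes "a \<in> H" "b \<in> H" "c \<in> H" "x \<in> a \<odot> b" "y \<in> x \<odot> c"
  obtains z where "z \<in> b \<odot> c" "y \<in> a \<odot> z"
  using mult_assoc[of a b c] assms by blast

lemma assoc_left:
  assumes "a \<in> H" "b \<in> H" "c \<in> H" "x \<in> b \<odot> c" "y \<in> a \<odot> x"
  obtains z where "z \<in> a \<odot> b" "y \<in> z \<odot> c"
  using mult_assoc[of a b c] assms by blast

text \<open>Transposition of \<open>a \<in> e \<odot> a\<close> and \<open>b \<in> e \<odot> b\<close> gives a common element of \<open>a \<odot> b\<close> and \<open>b \<odot> a\<close>.\<close>
lemma mult_nonempty:
  assumes "a \<in> H" "b \<in> H"
  shows "a \<odot> b \<noteq> {}"
  using transposition[of e a a b b] assms by (auto simp: mult_identity identity_closed)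

text \<open>Transposition of \<open>c \<in> b \<odot> a\<close> and \<open>e \<in> b \<odot> b'\<close> shows that \<open>c \<odot> b'\<close> meets \<open>e \<odot> a = {a}\<close>.\<close>
lemma reversibility:
  assumes "a \<in> H" "b \<in> H" "b' \<in> H" "e \<in> b \<odot> b'" "c \<in> a \<odot> b"
  shows "a \<in> c \<odot> b'"
proof -
  have "c \<in> H" using mult_closed assms by blast
  then have "(c \<odot> b') \<inter> (e \<odot> a) \<noteq> {}"
    using transposition[of b c a e b'] assms by (auto simp: mult_commute identity_closed)
  then show ?thesis using assms by (simp add: mult_identity)
qed

lemma inverse_unique:
  assumes "x \<in> H" "y \<in> H" "z \<in> H" "e \<in> x \<odot> y" "e \<in> x \<odot> z"
  shows "y = z"
  using reversibility[of y x z e] assms by (auto simp: mult_commute mult_identity)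

lemma closed_subset_carrier: "closed_subset H"
  unfolding closed_subset_def using identity_closed by (auto intro: mult_closed)

lemma adjoint_generators_subset_adjoint: "adjoint_generators K \<subseteq> adjoint K"
  by (auto simp: adjoint_def)

lemma adjoint_least: "\<lbrakk>closed_subset L; adjoint_generators K \<subseteq> L\<rbrakk> \<Longrightarrow> adjoint K \<subseteq> L"
  by (auto simp: adjoint_def)

lemma closed_subset_adjoint: "closed_subset (adjoint K)"
proof -
  have "adjoint K \<subseteq> H"
    by (rule adjoint_least[OF closed_subset_carrier]) (auto simp: adjoint_generators_def)
  moreover have "e \<in> adjoint K" by (simp add: adjoint_def closed_subset_def)
  moreover have "a \<odot> b \<subseteq> adjoint K" if "a \<in> adjoint K" "b \<in> adjoint K" for a b
    unfolding adjoint_def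
  proof (rule Inter_greatest)
    fix L assume L: "L \<in> {L. closed_subset L \<and> adjoint_generators K \<subseteq> L}"
    then have "a \<in> L" "b \<in> L" using that by (auto simp: adjoint_def)
    then show "a \<odot> b \<subseteq> L" using L by (simp add: closed_subset_def)
  qed
  ultimately show ?thesis unfolding closed_subset_def[of "adjoint K"] by blast
qed

lemma closed_subset_adjoint_series: "closed_subset (adjoint_series n)"
  by (cases n) (auto simp: adjoint_series_0 adjoint_series_Suc closed_subset_carrier closed_subset_adjoint)

lemma adjoint_series_SucI:
  assumes "c \<in> H" "a \<in> adjoint_series n" "a \<in> c \<odot> a"
  shows "c \<in> adjoint_series (Suc n)"
  using adjoint_generators_subset_adjoint[of "adjoint_series n"] assms
  by (auto simp: adjoint_series_Suc adjoint_generators_def)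

text \<open>
  Write \<open>s \<rightarrow> t\<close> if \<open>t \<in> q \<odot> s\<close> for some \<open>q \<in> I\<close>.  On the finite set of those elements of \<open>I\<close>
  that lie in the \<open>n\<close>-th term this relation is transitive and every element has a successor, so some
  \<open>s\<close> satisfies \<open>s \<rightarrow> s\<close>.  The \<open>q\<close> responsible for it stabilises \<open>s\<close> and hence lies in the next term.
\<close>
lemma subsemigroup_meets_adjoint_series:
  assumes I: "I \<subseteq> H" "I \<noteq> {}" "\<And>a b. \<lbrakk>a \<in> I; b \<in> I\<rbrakk> \<Longrightarrow> a \<odot> b \<subseteq> I"
  shows "I \<inter> adjoint_series n \<noteq> {}"
proof (induction n)
  case 0
  then show ?case using I by (auto simp: adjoint_series_0)
next
  case (Suc n)
  let ?A = "I \<inter> adjoint_series n"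
  define R where "R s t \<longleftrightarrow> (\<exists>q \<in> I. t \<in> q \<odot> s)" for s t
  have closed: "a \<odot> b \<subseteq> ?A" if "a \<in> ?A" "b \<in> ?A" for a b
    using that I(3) closed_subset_adjoint_series[of n] unfolding closed_subset_def by blast
  have trans: "transp_on ?A R"
  proof (rule transp_onI)
    fix s t u assume "s \<in> ?A" "t \<in> ?A" "u \<in> ?A" and "R s t" "R t u"
    then obtain p q where pq: "p \<in> I" "t \<in> p \<odot> s" "q \<in> I" "u \<in> q \<odot> t"
      by (auto simp: R_def)
    then obtain z where "z \<in> q \<odot> p" "u \<in> z \<odot> s"
      using assoc_left[of q p s t u] I(1) \<open>s \<in> ?A\<close> by blast
    then show "R s u" using I(3) pq by (auto simp: R_def)
  qed
  have serial: "\<exists>t \<in> ?A. R s t" if s: "s \<in> ?A" for s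
  proof -
    obtain t where "t \<in> s \<odot> s" using mult_nonempty[of s s] s I(1) by blast
    then show ?thesis using closed[OF s s] s by (auto simp: R_def)
  qed
  have "\<exists>s \<in> ?A. R s s"
  proof (rule ccontr)
    assume irrefl: "\<not> (\<exists>s \<in> ?A. R s s)"
    then have "asymp_on ?A R"
      using trans by (auto simp: asymp_on_def transp_on_def)
    then obtain s where s: "s \<in> ?A" "\<And>t. t \<in> ?A \<Longrightarrow> t \<noteq> s \<Longrightarrow> \<not> R s t"
      using Finite_Set.bex_max_element[of ?A R] trans Suc.IH finite_subset[OF I(1) finite_carrier] by auto
    then show False using serial[OF s(1)] irrefl by blast
  qed
  then obtain s q where "s \<in> ?A" "q \<in> I" "s \<in> q \<odot> s" by (auto simp: R_def)
  then have "q \<in> I \<inter> adjoint_series (Suc n)"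
    using adjoint_series_SucI[of q s n] I(1) by blast
  then show ?case by blast
qed

end

locale nilpotent_hypergroup = finite_canonical_hypergroup +
  assumes nilpotent: "\<exists>n. adjoint_series n = {e}"
begin

lemma identity_in_subsemigroup:
  assumes "I \<subseteq> H" "I \<noteq> {}" "\<And>a b. \<lbrakk>a \<in> I; b \<in> I\<rbrakk> \<Longrightarrow> a \<odot> b \<subseteq> I"
  shows "e \<in> I"
  using subsemigroup_meets_adjoint_series[OF assms] nilpotent by (metis Int_insert_right_if0 Int_empty_right)

text \<open>
  The elements of \<open>D\<close> that are divisible by \<open>y\<close> within \<open>D\<close> form a nonempty subsemigroup, which
  therefore contains the identity.
\<close>
lemma closed_subset_inverse:
  assumes D: "closed_subset D" and y: "y \<in> D" and y': "y' \<in> H" "e \<in> y \<odot> y'"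
  shows "y' \<in> D"
proof -
  let ?I = "{w \<in> D. \<exists>z \<in> D. w \<in> y \<odot> z}"
  have DH: "D \<subseteq> H" and eD: "e \<in> D" and DD: "\<And>a b. a \<in> D \<Longrightarrow> b \<in> D \<Longrightarrow> a \<odot> b \<subseteq> D"
    using D by (auto simp: closed_subset_def)
  have "e \<in> ?I"
  proof (rule identity_in_subsemigroup)
    show "?I \<subseteq> H" using DH by blast
    have "y \<in> y \<odot> e"
      using mult_identity[of y] mult_commute[of y e] y DH identity_closed by auto
    then show "?I \<noteq> {}" using y eD by blast
    fix a b assume ab: "a \<in> ?I" "b \<in> ?I"
    then obtain z where z: "z \<in> D" "a \<in> y \<odot> z" by blast
    show "a \<odot> b \<subseteq> ?I"
    proof
      fix c assume c: "c \<in> a \<odot> b"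
      then obtain t where "t \<in> z \<odot> b" "c \<in> y \<odot> t"
        using assoc_right[of y z b a c] z ab y DH by blast
      moreover have "t \<in> D" using DD[of z b] z ab \<open>t \<in> z \<odot> b\<close> by blast
      moreover have "c \<in> D" using DD[of a b] c ab by blast
      ultimately show "c \<in> ?I" by blast
    qed
  qed
  then obtain z where "z \<in> D" "e \<in> y \<odot> z" by blast
  then show ?thesis using inverse_unique[of y z y'] y y' DH by blast
qed

text \<open>
  The product \<open>M\<close> of \<open>D\<close> with the term of index \<open>n + 2\<close> is closed, so for the induction step it is
  enough to find in it the generators of the term of index \<open>n + 1\<close>.  Such a generator \<open>c\<close> lies in
  \<open>a \<odot> a'\<close> for some \<open>a\<close> in the \<open>n\<close>-th term, where \<open>a'\<close> is the inverse of \<open>a\<close>.  If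
  \<open>a \<in> x \<odot> z\<close> as in the induction hypothesis, then \<open>a'\<close> lies in the product of the inverses of \<open>x\<close>
  and \<open>z\<close>, and commutativity moves \<open>c\<close> into \<open>(x \<odot> x') \<odot> (z \<odot> z')\<close>.  The first factor lies in
  \<open>D\<close> because \<open>D\<close> is closed under inverses; the second consists of stabilisers of \<open>z\<close>.
\<close>
lemma adjoint_series_factorization:
  assumes D: "closed_subset D"
    and supplement: "\<And>a. a \<in> H \<Longrightarrow> \<exists>x \<in> D. \<exists>z \<in> adjoint_series 1. a \<in> x \<odot> z"
  shows "a \<in> adjoint_series n \<Longrightarrow> \<exists>x \<in> D. \<exists>z \<in> adjoint_series (Suc n). a \<in> x \<odot> z"
proof (induction n arbitrary: a)
  case 0
  then show ?case using supplement by (auto simp: adjoint_series_0)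
next
  case (Suc n)
  let ?S = adjoint_series
  let ?M = "{a. \<exists>x \<in> D. \<exists>z \<in> ?S (Suc (Suc n)). a \<in> x \<odot> z}"
  have DH: "D \<subseteq> H" and eD: "e \<in> D" and DD: "\<And>a b c. a \<in> D \<Longrightarrow> b \<in> D \<Longrightarrow> c \<in> a \<odot> b \<Longrightarrow> c \<in> D"
    using D by (auto simp: closed_subset_def)
  have SH: "?S k \<subseteq> H" and eS: "e \<in> ?S k"
    and SS: "\<And>a b c. a \<in> ?S k \<Longrightarrow> b \<in> ?S k \<Longrightarrow> c \<in> a \<odot> b \<Longrightarrow> c \<in> ?S k" for k
    using closed_subset_adjoint_series[of k] by (auto simp: closed_subset_def)
  \<comment> \<open>the interchange \<open>(x z) (y w) \<subseteq> (x y) (z w)\<close>\<close>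
  have interchange: "\<exists>p q. p \<in> x \<odot> y \<and> q \<in> z \<odot> w \<and> c \<in> p \<odot> q"
    if H: "x \<in> H" "y \<in> H" "z \<in> H" "w \<in> H" and ab: "a \<in> x \<odot> z" "b \<in> y \<odot> w" and c: "c \<in> a \<odot> b"
    for a b c x y z w
  proof -
    have bH: "b \<in> H" using mult_closed[OF H(2,4) ab(2)] .
    obtain t where t: "t \<in> z \<odot> b" "c \<in> x \<odot> t"
      using assoc_right[OF H(1,3) bH ab(1) c] .
    have tt: "t \<in> b \<odot> z" using t mult_commute[of z b] H bH by blast
    obtain q where q: "q \<in> w \<odot> z" "t \<in> y \<odot> q"
      using assoc_right[OF H(2,4,3) ab(2) tt] .
    have qq: "q \<in> z \<odot> w" using q mult_commute[of z w] H by blast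
    have qH: "q \<in> H" using mult_closed[OF H(3,4) qq] .
    obtain p where p: "p \<in> x \<odot> y" "c \<in> p \<odot> q"
      using assoc_left[OF H(1,2) qH q(2) t(2)] .
    show ?thesis using p qq by blast
  qed
  have M: "closed_subset ?M"
    unfolding closed_subset_def
  proof (intro conjI ballI subsetI)
    show "x \<in> H" if "x \<in> ?M" for x
      using that mult_closed DH SH by blast
    show "e \<in> ?M"
      using eD eS mult_identity[OF identity_closed] by blast
    fix a b c assume "a \<in> ?M" "b \<in> ?M" and c: "c \<in> a \<odot> b"
    then obtain x z y w where "x \<in> D" "y \<in> D" "z \<in> ?S (Suc (Suc n))" "w \<in> ?S (Suc (Suc n))"
      "a \<in> x \<odot> z" "b \<in> y \<odot> w" by blast
    then show "c \<in> ?M"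
      using interchange[of x y z w a b c] c DD[of x y] SS[of z "Suc (Suc n)" w] DH SH by blast
  qed
  have "adjoint_generators (?S n) \<subseteq> ?M"
  proof
    fix c assume "c \<in> adjoint_generators (?S n)"
    then obtain a where c: "c \<in> H" and a: "a \<in> ?S n" "a \<in> c \<odot> a"
      by (auto simp: adjoint_generators_def)
    obtain x z where xz: "x \<in> D" "z \<in> ?S (Suc n)" "a \<in> x \<odot> z"
      using Suc.IH[OF a(1)] by blast
    have H: "a \<in> H" "x \<in> H" "z \<in> H" using a xz DH SH by blast+
    obtain a' x' z' where inv: "a' \<in> H" "e \<in> a \<odot> a'" "x' \<in> H" "e \<in> x \<odot> x'"
      "z' \<in> H" "e \<in> z \<odot> z'"
      using inverse_exists[OF H(1)] inverse_exists[OF H(2)] inverse_exists[OF H(3)] by blast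
    have ca: "c \<in> a \<odot> a'"
      using reversibility[OF c H(1) inv(1,2) a(2)] .
    obtain u where u: "u \<in> z \<odot> a'" "e \<in> x \<odot> u"
      using assoc_right[OF H(2,3) inv(1) xz(3) inv(2)] .
    have uH: "u \<in> H" using mult_closed[OF H(3) inv(1) u(1)] .
    have "u = x'" using inverse_unique[OF H(2) uH inv(3) u(2) inv(4)] .
    then have "x' \<in> a' \<odot> z" using u(1) mult_commute[of z a'] H inv by blast
    then have a'x: "a' \<in> x' \<odot> z'" using reversibility[of a' z z' x'] H inv by blast
    then obtain p q where pq: "p \<in> x \<odot> x'" "q \<in> z \<odot> z'" "c \<in> p \<odot> q"
      using interchange[OF H(2) inv(3) H(3) inv(5) xz(3) a'x ca] by blast
    have "x' \<in> D" using closed_subset_inverse[OF D xz(1) inv(3,4)] .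
    then have "p \<in> D" using DD[OF xz(1) _ pq(1)] by blast
    have "z \<in> q \<odot> z"
      using reversibility[of z z' z q] H inv pq mult_commute[of z z'] by blast
    then have "q \<in> ?S (Suc (Suc n))"
      using adjoint_series_SucI[OF _ xz(2)] mult_closed[OF H(3) inv(5) pq(2)] by blast
    with \<open>p \<in> D\<close> pq(3) show "c \<in> ?M" by blast
  qed
  then have "?S (Suc n) \<subseteq> ?M"
    unfolding adjoint_series_Suc[of n] using M by (rule adjoint_least[rotated])
  then show ?case using Suc.prems by blast
qed

text \<open>
  Descending along the series from its trivial end, each term lies in \<open>D\<close> because it is contained
  in the product of \<open>D\<close> with the next one.
\<close>
theorem closed_supplement_of_adjoint:
  assumes D: "closed_subset D"
    and supplement: "\<And>a. a \<in> H \<Longrightarrow> \<exists>x \<in> D. \<exists>z \<in> adjoint_series 1. a \<in> x \<odot> z"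
  shows "D = H"
proof -
  obtain n where n: "adjoint_series n = {e}" using nilpotent by blast
  have "adjoint_series (n - k) \<subseteq> D" if "k \<le> n" for k
    using that
  proof (induction k)
    case 0
    then show ?case using n D by (simp add: closed_subset_def)
  next
    case (Suc k)
    then have "Suc (n - Suc k) = n - k" by simp
    then have "\<exists>x \<in> D. \<exists>z \<in> D. a \<in> x \<odot> z" if "a \<in> adjoint_series (n - Suc k)" for a
      using adjoint_series_factorization[OF D supplement that] Suc by fastforce
    then show ?case using D unfolding closed_subset_def by blast
  qed
  from this[of n] show ?thesis using D by (auto simp: adjoint_series_0 closed_subset_def)
qed

end

section \<open>Simple objects and direct sums\<close>

text \<open>
  In a semisimple category this relation is symmetric and means that \<open>X\<close> and \<open>Y\<close> have a simple
  constituent in common.  For simple \<open>X\<close> it means that \<open>X\<close> is a constituent of \<open>Y\<close>.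
\<close>
definition linked :: "('o, 'm, 'k, 'z) linear_cat_scheme \<Rightarrow> 'o \<Rightarrow> 'o \<Rightarrow> bool" where
  "linked C X Y \<longleftrightarrow> (\<exists>f \<in> Hom C X Y. f \<noteq> Zero C X Y)"

context linear_category
begin

lemma comp_in_Arr:
  assumes "f \<in> Arr C" "g \<in> Arr C" "Cod C f = Dom C g"
  shows "g \<cdot> f \<in> Arr C" "Dom C (g \<cdot> f) = Dom C f" "Cod C (g \<cdot> f) = Cod C g"
  using comp_hom[of f "Dom C f" "Cod C f" g "Cod C g"] assms by (auto simp: Hom_def)

lemma Id_in_Arr:
  assumes "X \<in> Obj C"
  shows "Id C X \<in> Arr C" "Dom C (Id C X) = X" "Cod C (Id C X) = X"
  using id_hom[OF assms] by (auto simp: Hom_def)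

lemma comp_assoc_Arr:
  assumes "f \<in> Arr C" "g \<in> Arr C" "h \<in> Arr C" "Cod C f = Dom C g" "Cod C g = Dom C h"
  shows "(h \<cdot> g) \<cdot> f = h \<cdot> (g \<cdot> f)"
  using comp_assoc[of f "Dom C f" "Dom C g" g "Dom C h" h "Cod C h"] assms by (auto simp: Hom_def)

lemma comp_Id_Arr:
  assumes "f \<in> Arr C"
  shows "f \<cdot> Id C (Dom C f) = f" "Id C (Cod C f) \<cdot> f = f"
  using comp_id_right[of f] comp_id_left[of f] assms by (auto simp: Hom_def)

lemma Hom_obj:
  assumes "f \<in> Hom C X Y"
  shows "X \<in> Obj C" "Y \<in> Obj C"
  using assms dom_obj cod_obj by (auto simp: Hom_def)

lemma Zero_in_Hom: "\<lbrakk>X \<in> Obj C; Y \<in> Obj C\<rbrakk> \<Longrightarrow> Zero C X Y \<in> Hom C X Y"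
  using comm_groupE(2)[OF hom_comm_group] by (simp add: hom_group_def)

lemma Add_in_Hom: "\<lbrakk>f \<in> Hom C X Y; g \<in> Hom C X Y\<rbrakk> \<Longrightarrow> Add C f g \<in> Hom C X Y"
  using comm_groupE(1)[OF hom_comm_group] Hom_obj[of f X Y] by (simp add: hom_group_def)

lemma Add_Zero:
  assumes "f \<in> Hom C X Y"
  shows "Add C (Zero C X Y) f = f" "Add C f (Zero C X Y) = f"
  using comm_groupE(5)[OF hom_comm_group, of X Y f] comm_groupE(4)[OF hom_comm_group, of X Y f "Zero C X Y"]
    Hom_obj[OF assms] Zero_in_Hom[of X Y] assms by (auto simp: hom_group_def)

text \<open>
  Through this criterion additivity implies that composition and the tensor product preserve zero
  morphisms and that the scalar \<open>0\<close> annihilates every morphism.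
\<close>
lemma Add_idem_Zero:
  assumes "f \<in> Hom C X Y" "Add C f f = f"
  shows "f = Zero C X Y"
proof -
  interpret G: comm_group "hom_group C X Y"
    using hom_comm_group Hom_obj[OF assms(1)] by blast
  show ?thesis
    using G.l_cancel_one[of f f] assms by (simp add: hom_group_def)
qed

lemma Add_assoc:
  "\<lbrakk>f \<in> Hom C X Y; g \<in> Hom C X Y; h \<in> Hom C X Y\<rbrakk> \<Longrightarrow> Add C (Add C f g) h = Add C f (Add C g h)"
  using comm_groupE(3)[OF hom_comm_group, of X Y f g h] Hom_obj[of f X Y] by (simp add: hom_group_def)

lemma comp_Zero_right:
  assumes "f \<in> Hom C Y Z" "X \<in> Obj C"
  shows "f \<cdot> Zero C X Y = Zero C X Z"
proof (rule Add_idem_Zero)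
  have Z: "Zero C X Y \<in> Hom C X Y" using Zero_in_Hom Hom_obj assms by blast
  then show "f \<cdot> Zero C X Y \<in> Hom C X Z" using comp_hom assms by blast
  show "Add C (f \<cdot> Zero C X Y) (f \<cdot> Zero C X Y) = f \<cdot> Zero C X Y"
    using comp_add_right[OF Z Z assms(1)] Add_Zero(1)[OF Z] by simp
qed

lemma comp_Zero_left:
  assumes "f \<in> Hom C X Y" "Z \<in> Obj C"
  shows "Zero C Y Z \<cdot> f = Zero C X Z"
proof (rule Add_idem_Zero)
  have Z: "Zero C Y Z \<in> Hom C Y Z" using Zero_in_Hom Hom_obj assms by blast
  then show "Zero C Y Z \<cdot> f \<in> Hom C X Z" using comp_hom assms by blast
  show "Add C (Zero C Y Z \<cdot> f) (Zero C Y Z \<cdot> f) = Zero C Y Z \<cdot> f"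
    using comp_add_left[OF assms(1) Z Z] Add_Zero(1)[OF Z] by simp
qed

definition Neg :: "'m \<Rightarrow> 'm" where "Neg f = Smult C (- 1) f"

lemma Neg_in_Hom: "f \<in> Hom C X Y \<Longrightarrow> Neg f \<in> Hom C X Y"
  by (simp add: Neg_def smult_hom)

lemma Add_Neg:
  assumes f: "f \<in> Hom C X Y"
  shows "Add C f (Neg f) = Zero C X Y" "Add C (Neg f) f = Zero C X Y"
proof -
  have "Smult C 0 f = Zero C X Y"
    using Add_idem_Zero[OF smult_hom[OF f, of 0]] smult_add_left[OF f, of 0 0] by simp
  then show "Add C f (Neg f) = Zero C X Y" "Add C (Neg f) f = Zero C X Y"
    using smult_add_left[OF f, of 1 "-1"] smult_add_left[OF f, of "-1" 1] smult_one[OF f]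
    by (simp_all add: Neg_def)
qed

lemma Add_Neg_eq_Zero:
  assumes f: "f \<in> Hom C X Y" and g: "g \<in> Hom C X Y" and eq: "Add C f (Neg g) = Zero C X Y"
  shows "f = g"
proof -
  have "f = Add C f (Add C (Neg g) g)" using Add_Neg[OF g] Add_Zero[OF f] by simp
  also have "\<dots> = Add C (Add C f (Neg g)) g" using Add_assoc[OF f Neg_in_Hom[OF g] g] by simp
  finally show ?thesis using eq Add_Zero[OF g] by simp
qed

lemma is_monoI:
  assumes f: "f \<in> Hom C X Y"
    and Z: "\<And>W g. \<lbrakk>g \<in> Hom C W X; f \<cdot> g = Zero C W Y\<rbrakk> \<Longrightarrow> g = Zero C W X"
  shows "is_mono C f"
  unfolding is_mono_def
proof (intro conjI allI ballI impI)
  show "f \<in> Arr C" using f by (simp add: Hom_def)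
  have X: "Dom C f = X" using f by (simp add: Hom_def)
  fix W g h assume "g \<in> Hom C W (Dom C f)" "h \<in> Hom C W (Dom C f)" and eq: "f \<cdot> g = f \<cdot> h"
  then have g: "g \<in> Hom C W X" and h: "h \<in> Hom C W X" using X by auto
  have "f \<cdot> Add C g (Neg h) = Add C (f \<cdot> g) (Neg (f \<cdot> h))"
    using comp_add_right[OF g Neg_in_Hom[OF h] f] comp_smult_right[OF h f] by (simp add: Neg_def)
  also have "\<dots> = Zero C W Y" using eq Add_Neg[OF comp_hom[OF h f]] by simp
  finally have "Add C g (Neg h) = Zero C W X"
    using Z Add_in_Hom[OF g Neg_in_Hom[OF h]] by blast
  then show "g = h" using Add_Neg_eq_Zero[OF g h] by blast
qed

lemma is_mono_comp_Zero:
  assumes "is_mono C f" "f \<in> Hom C X Y" "g \<in> Hom C W X" "f \<cdot> g = Zero C W Y"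
  shows "g = Zero C W X"
proof -
  have "f \<cdot> Zero C W X = Zero C W Y" using comp_Zero_right Hom_obj assms by blast
  then show ?thesis
    using assms Zero_in_Hom[of W X] Hom_obj[OF assms(3)] unfolding is_mono_def Hom_def by auto
qed

lemma inverse_arrowsE:
  assumes "is_iso C f" "f \<in> Hom C X Y"
  obtains g where "g \<in> Hom C Y X" "g \<cdot> f = Id C X" "f \<cdot> g = Id C Y"
  using assms by (auto simp: is_iso_def inverse_arrows_def Hom_def)

lemma is_isoI:
  assumes "f \<in> Hom C X Y" "g \<in> Hom C Y X" "g \<cdot> f = Id C X" "f \<cdot> g = Id C Y"
  shows "is_iso C f"
  using assms by (auto simp: is_iso_def inverse_arrows_def Hom_def)

lemma retraction_comp_Zero:
  assumes "i \<in> Hom C X Y" "p \<in> Hom C Y X" "p \<cdot> i = Id C X" "g \<in> Hom C W X" "i \<cdot> g = Zero C W Y"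
  shows "g = Zero C W X"
proof -
  have "g = (p \<cdot> i) \<cdot> g" using comp_id_left assms by simp
  also have "\<dots> = p \<cdot> (i \<cdot> g)" using comp_assoc assms by blast
  also have "\<dots> = Zero C W X" using comp_Zero_right Hom_obj assms by simp
  finally show ?thesis .
qed

lemma section_comp_Zero:
  assumes "i \<in> Hom C X Y" "p \<in> Hom C Y X" "p \<cdot> i = Id C X" "g \<in> Hom C X W" "g \<cdot> p = Zero C Y W"
  shows "g = Zero C X W"
proof -
  have "g = g \<cdot> (p \<cdot> i)" using comp_id_right assms by simp
  also have "\<dots> = (g \<cdot> p) \<cdot> i" using comp_assoc assms by metis
  also have "\<dots> = Zero C X W" using comp_Zero_left Hom_obj assms by simp
  finally show ?thesis .
qed

lemma linked_comp_iso_right: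
  assumes "is_iso C f" "f \<in> Hom C X X'"
  shows "linked C X Y \<longleftrightarrow> linked C X' Y"
proof -
  obtain g where g: "g \<in> Hom C X' X" "g \<cdot> f = Id C X" "f \<cdot> g = Id C X'"
    using inverse_arrowsE[OF assms] .
  have "linked C X' Y" if "h \<in> Hom C X Y" "h \<noteq> Zero C X Y" for h
    using comp_hom[OF g(1) that(1)] section_comp_Zero[OF assms(2) g(1,2) that(1)] that(2)
    by (auto simp: linked_def)
  moreover have "linked C X Y" if "h \<in> Hom C X' Y" "h \<noteq> Zero C X' Y" for h
    using comp_hom[OF assms(2) that(1)] section_comp_Zero[OF g(1) assms(2) g(3) that(1)] that(2)
    by (auto simp: linked_def)
  ultimately show ?thesis by (auto simp: linked_def[of C X] linked_def[of C X'])
qed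

lemma linked_comp_iso_left:
  assumes "is_iso C f" "f \<in> Hom C Y Y'"
  shows "linked C X Y \<longleftrightarrow> linked C X Y'"
proof -
  obtain g where g: "g \<in> Hom C Y' Y" "g \<cdot> f = Id C Y" "f \<cdot> g = Id C Y'"
    using inverse_arrowsE[OF assms] .
  have "linked C X Y'" if "h \<in> Hom C X Y" "h \<noteq> Zero C X Y" for h
    using comp_hom[OF that(1) assms(2)] retraction_comp_Zero[OF assms(2) g(1,2) that(1)] that(2)
    by (auto simp: linked_def)
  moreover have "linked C X Y" if "h \<in> Hom C X Y'" "h \<noteq> Zero C X Y'" for h
    using comp_hom[OF that(1) g(1)] retraction_comp_Zero[OF g(1) assms(2) g(3) that(1)] that(2)
    by (auto simp: linked_def)
  ultimately show ?thesis by (auto simp: linked_def[of C X Y] linked_def[of C X Y'])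
qed

lemma zero_object_iff_Id:
  assumes "X \<in> Obj C"
  shows "zero_object C X \<longleftrightarrow> Id C X = Zero C X X"
proof
  assume "zero_object C X"
  then show "Id C X = Zero C X X"
    using id_hom[OF assms] Zero_in_Hom[OF assms assms] assms unfolding zero_object_def by blast
next
  assume eq: "Id C X = Zero C X X"
  have "f = Zero C X Y" if "f \<in> Hom C X Y" for f Y
    using comp_id_right[OF that] comp_Zero_right[OF that assms] eq by simp
  moreover have "f = Zero C Y X" if "f \<in> Hom C Y X" for f Y
    using comp_id_left[OF that] comp_Zero_left[OF that assms] eq by simp
  ultimately show "zero_object C X"
    unfolding zero_object_def using assms Zero_in_Hom[OF assms] Zero_in_Hom[OF _ assms] by blast
qed

lemma simple_object_Id:
  assumes "simple_object C S"
  shows "S \<in> Obj C" "Id C S \<noteq> Zero C S S"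
  using assms zero_object_iff_Id by (auto simp: simple_object_def)

text \<open>
  A form of \<open>Id = \<Sum> i \<cdot> p\<close> over the summands: since only membership in an additively closed class of
  endomorphisms is ever used, it takes the form of an induction rule.
\<close>
lemma direct_sum_Id_induct:
  assumes "direct_sum C X Xs"
    and "P (Zero C X X)"
    and "\<And>f g. \<lbrakk>f \<in> Hom C X X; g \<in> Hom C X X; P f; P g\<rbrakk> \<Longrightarrow> P (Add C f g)"
    and "\<And>S i p. \<lbrakk>S \<in> set Xs; i \<in> Hom C S X; p \<in> Hom C X S; p \<cdot> i = Id C S\<rbrakk> \<Longrightarrow> P (i \<cdot> p)"
  shows "P (Id C X)"
  using assms
proof (induction arbitrary: P rule: direct_sum.induct)
  case (Nil Z)
  then have "Z \<in> Obj C" by (auto simp: zero_object_def)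
  then show ?case using Nil zero_object_iff_Id[of Z] by simp
next
  case (Cons Z' Xs Z X)
  obtain i j p q where h: "i \<in> Hom C X Z" "j \<in> Hom C Z' Z" "p \<in> Hom C Z X" "q \<in> Hom C Z Z'"
    "p \<cdot> i = Id C X" "q \<cdot> j = Id C Z'" "Add C (i \<cdot> p) (j \<cdot> q) = Id C Z"
    using Cons.hyps(2) by (auto simp: biproduct_def)
  have Z: "Z \<in> Obj C" "Z' \<in> Obj C" using Hom_obj h by blast+
  \<comment> \<open>the induction hypothesis is applied to the endomorphisms of \<open>Z'\<close> transported to \<open>Z\<close>\<close>
  let ?Q = "\<lambda>f. P (j \<cdot> (f \<cdot> q))"
  have "?Q (Id C Z')"
  proof (rule Cons.IH)
    show "?Q (Zero C Z' Z')"
      using comp_Zero_left[OF h(4) Z(2)] comp_Zero_right[OF h(2) Z(1)] Cons.prems(1) by simp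
  next
    fix f g assume fg: "f \<in> Hom C Z' Z'" "g \<in> Hom C Z' Z'" and Q: "?Q f" "?Q g"
    have "f \<cdot> q \<in> Hom C Z Z'" "g \<cdot> q \<in> Hom C Z Z'" using comp_hom h(4) fg by blast+
    then have "j \<cdot> (f \<cdot> q) \<in> Hom C Z Z" "j \<cdot> (g \<cdot> q) \<in> Hom C Z Z"
      "j \<cdot> (Add C f g \<cdot> q) = Add C (j \<cdot> (f \<cdot> q)) (j \<cdot> (g \<cdot> q))"
      using comp_add_left[OF h(4) fg] comp_add_right[OF _ _ h(2)] comp_hom[OF _ h(2)] by auto
    then show "?Q (Add C f g)" using Cons.prems(2) Q by simp
  next
    fix S i' p' assume S: "S \<in> set Xs" and i': "i' \<in> Hom C S Z'" and p': "p' \<in> Hom C Z' S"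
      and eq: "p' \<cdot> i' = Id C S"
    have "(p' \<cdot> q) \<cdot> (j \<cdot> i') = p' \<cdot> ((q \<cdot> j) \<cdot> i')"
      using comp_assoc[OF i' h(2,4)] comp_assoc[OF comp_hom[OF i' h(2)] h(4) p'] by simp
    also have "\<dots> = Id C S" using comp_id_left[OF i'] h(6) eq by simp
    finally have "P ((j \<cdot> i') \<cdot> (p' \<cdot> q))"
      using Cons.prems(3)[of S "j \<cdot> i'" "p' \<cdot> q"] S comp_hom[OF i' h(2)] comp_hom[OF h(4) p'] by simp
    then show "?Q (i' \<cdot> p')"
      using comp_assoc[OF h(4) p' i'] comp_assoc[OF comp_hom[OF h(4) p'] i' h(2)] by simp
  qed
  then have "P (j \<cdot> q)" using comp_id_left[OF h(4)] by simp
  moreover have "P (i \<cdot> p)" using Cons.prems(3)[of X i p] h by simp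
  ultimately have "P (Add C (i \<cdot> p) (j \<cdot> q))"
    using Cons.prems(2) comp_hom h by blast
  then show ?case using h(7) by simp
qed

lemma direct_sum_nonzero_summand:
  assumes X: "direct_sum C X Xs" and f: "f \<in> Hom C X Y" "f \<noteq> Zero C X Y"
  obtains S i p where "S \<in> set Xs" "i \<in> Hom C S X" "p \<in> Hom C X S" "p \<cdot> i = Id C S"
    "f \<cdot> i \<noteq> Zero C S Y"
proof (rule ccontr)
  note found = that
  assume "\<not> thesis"
  then have Z: "f \<cdot> i = Zero C S Y"
    if "S \<in> set Xs" "i \<in> Hom C S X" "p \<in> Hom C X S" "p \<cdot> i = Id C S" for S i p
    using that found \<open>\<not> thesis\<close> by blast
  have obj: "X \<in> Obj C" "Y \<in> Obj C" using Hom_obj f by blast+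
  have "f \<cdot> Id C X = Zero C X Y"
  proof (rule direct_sum_Id_induct[OF X])
    show "f \<cdot> Zero C X X = Zero C X Y" using comp_Zero_right f obj by blast
    show "f \<cdot> Add C g h = Zero C X Y"
      if "g \<in> Hom C X X" "h \<in> Hom C X X" "f \<cdot> g = Zero C X Y" "f \<cdot> h = Zero C X Y" for g h
      using comp_add_right[OF that(1,2) f(1)] that Add_Zero Zero_in_Hom obj by simp
    show "f \<cdot> (i \<cdot> p) = Zero C X Y"
      if "S \<in> set Xs" "i \<in> Hom C S X" "p \<in> Hom C X S" "p \<cdot> i = Id C S" for S i p
      using comp_assoc[OF that(3,2) f(1)] Z[OF that] comp_Zero_left[OF that(3) obj(2)] by simp
  qed
  then show False using comp_id_right f by simp
qed

end

context linear_abelian_category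
begin

text \<open>
  The kernel of \<open>f\<close> is a subobject of the simple object \<open>S\<close>; it is not all of \<open>S\<close> because
  \<open>f \<noteq> 0\<close>, so it is zero.
\<close>
lemma simple_nonzero_is_mono:
  assumes S: "simple_object C S" and f: "f \<in> Hom C S Y" "f \<noteq> Zero C S Y"
  shows "is_mono C f"
proof -
  obtain k where k: "is_kernel C f k" using ex_kernel f by (auto simp: Hom_def)
  define K where "K = Dom C k"
  have S': "Dom C f = S" "Cod C f = Y" using f by (auto simp: Hom_def)
  have kH: "k \<in> Hom C K S" and fk: "f \<cdot> k = Zero C K Y"
    and univ: "\<And>W g. g \<in> Hom C W S \<Longrightarrow> f \<cdot> g = Zero C W Y \<Longrightarrow> \<exists>!h. h \<in> Hom C W K \<and> k \<cdot> h = g"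
    using k S' by (auto simp: is_kernel_def K_def Hom_def)
  have YO: "Y \<in> Obj C" and KO: "K \<in> Obj C" using Hom_obj f kH by blast+
  have "is_mono C k"
  proof (rule is_monoI[OF kH])
    fix W g assume g: "g \<in> Hom C W K" "k \<cdot> g = Zero C W S"
    then have W: "W \<in> Obj C" and "S \<in> Obj C" using Hom_obj kH by blast+
    then have "f \<cdot> Zero C W S = Zero C W Y" "Zero C W S \<in> Hom C W S" "Zero C W K \<in> Hom C W K"
      "k \<cdot> Zero C W K = Zero C W S"
      using comp_Zero_right[OF f(1) W] comp_Zero_right[OF kH W] Zero_in_Hom KO by auto
    then show "g = Zero C W K" using univ[of "Zero C W S" W] g by blast
  qed
  then have "zero_object C K \<or> is_iso C k"
    using S kH unfolding simple_object_def by (auto simp: Hom_def)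
  moreover have "\<not> is_iso C k"
  proof
    assume "is_iso C k"
    then obtain l where l: "l \<in> Hom C S K" "k \<cdot> l = Id C S"
      using inverse_arrowsE[OF _ kH] by blast
    have "f = (f \<cdot> k) \<cdot> l" using comp_assoc[OF l(1) kH f(1)] l comp_id_right[OF f(1)] by simp
    then show False using fk comp_Zero_left[OF l(1) YO] f by simp
  qed
  ultimately have K0: "zero_object C K" by blast
  show ?thesis
  proof (rule is_monoI[OF f(1)])
    fix W g assume g: "g \<in> Hom C W S" "f \<cdot> g = Zero C W Y"
    then obtain h where h: "h \<in> Hom C W K" "k \<cdot> h = g" using univ by blast
    have W: "W \<in> Obj C" using Hom_obj g by blast
    have "h = Zero C W K" using K0 h Zero_in_Hom[OF W KO] W unfolding zero_object_def by blast
    then show "g = Zero C W S" using comp_Zero_right[OF kH W] h by simp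
  qed
qed

lemma schur_is_iso:
  assumes "simple_object C S" "simple_object C T" "f \<in> Hom C S T" "f \<noteq> Zero C S T"
  shows "is_iso C f"
  using simple_nonzero_is_mono[OF assms(1,3,4)] assms unfolding simple_object_def Hom_def by auto

end

section \<open>Frobenius reciprocity\<close>

context linear_category
begin

lemma inv_arr_inverse:
  assumes "is_iso C f" "f \<in> Hom C X Y"
  shows "inv_arr C f \<in> Hom C Y X" "inv_arr C f \<cdot> f = Id C X" "f \<cdot> inv_arr C f = Id C Y"
proof -
  obtain g where g: "g \<in> Hom C Y X" "g \<cdot> f = Id C X" "f \<cdot> g = Id C Y"
    using inverse_arrowsE[OF assms] .
  have "h = g" if "h \<in> Hom C Y X" "h \<cdot> f = Id C X" for h
  proof -
    have "h = h \<cdot> (f \<cdot> g)" using g(3) comp_id_right[OF that(1)] by simp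
    also have "\<dots> = (h \<cdot> f) \<cdot> g" using comp_assoc[OF g(1) assms(2) that(1)] by simp
    finally show ?thesis using that(2) comp_id_left[OF g(1)] by simp
  qed
  moreover have f: "f \<in> Arr C" "Dom C f = X" "Cod C f = Y" using assms(2) by (auto simp: Hom_def)
  ultimately have "inverse_arrows C f = (\<lambda>h. h = g)"
    unfolding inverse_arrows_def fun_eq_iff f(2,3) using g by blast
  then have "inv_arr C f = g" by (simp add: inv_arr_def)
  then show "inv_arr C f \<in> Hom C Y X" "inv_arr C f \<cdot> f = Id C X" "f \<cdot> inv_arr C f = Id C Y"
    using g by auto
qed

lemma is_iso_comp:
  assumes "is_iso C f" "f \<in> Hom C X Y" "is_iso C g" "g \<in> Hom C Y Z"
  shows "is_iso C (g \<cdot> f)"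
proof -
  note f = inv_arr_inverse[OF assms(1,2)] and g = inv_arr_inverse[OF assms(3,4)]
  have "(inv_arr C f \<cdot> inv_arr C g) \<cdot> (g \<cdot> f) = inv_arr C f \<cdot> ((inv_arr C g \<cdot> g) \<cdot> f)"
    using comp_assoc[OF comp_hom[OF assms(2,4)] g(1) f(1)] comp_assoc[OF assms(2,4) g(1)] by simp
  moreover have "(g \<cdot> f) \<cdot> (inv_arr C f \<cdot> inv_arr C g) = g \<cdot> ((f \<cdot> inv_arr C f) \<cdot> inv_arr C g)"
    using comp_assoc[OF comp_hom[OF g(1) f(1)] assms(2,4)] comp_assoc[OF g(1) f(1) assms(2)] by simp
  ultimately show ?thesis
    using is_isoI[OF comp_hom[OF assms(2,4)] comp_hom[OF g(1) f(1)]] f g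
      comp_id_left[OF assms(2)] comp_id_left[OF g(1)] by simp
qed

lemma is_iso_right_factor:
  assumes "w \<in> Hom C X Y" "is_iso C r" "r \<in> Hom C Y Z" "is_iso C (r \<cdot> w)"
  shows "is_iso C w"
proof -
  note r = inv_arr_inverse[OF assms(2,3)]
  have "is_iso C (inv_arr C r)" using is_isoI[OF r(1) assms(3)] r by blast
  then have "is_iso C (inv_arr C r \<cdot> (r \<cdot> w))"
    using is_iso_comp[OF assms(4) comp_hom[OF assms(1,3)]] r(1) by blast
  moreover have "inv_arr C r \<cdot> (r \<cdot> w) = w"
    using comp_assoc[OF assms(1,3) r(1)] r comp_id_left[OF assms(1)] by simp
  ultimately show ?thesis by simp
qed

lemma iso_comp_Zero:
  assumes "is_iso C u" "u \<in> Hom C X Y" "g \<in> Hom C W X" "u \<cdot> g = Zero C W Y"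
  shows "g = Zero C W X"
  using retraction_comp_Zero[OF assms(2) inv_arr_inverse(1,2)[OF assms(1,2)] assms(3,4)] .

lemma comp_iso_Zero:
  assumes "is_iso C u" "u \<in> Hom C X Y" "g \<in> Hom C Y Z" "g \<cdot> u = Zero C X Z"
  shows "g = Zero C Y Z"
proof -
  note u = inv_arr_inverse[OF assms(1,2)]
  show ?thesis using section_comp_Zero[OF u(1) assms(2) u(3) assms(3,4)] .
qed

lemma is_iso_Id: "X \<in> Obj C \<Longrightarrow> is_iso C (Id C X)"
  using is_isoI[OF id_hom id_hom] comp_id_left[OF id_hom] by blast

end

context tensor_category
begin

lemma tensor_Zero_left:
  assumes "X \<in> Obj C" "Y \<in> Obj C" "h \<in> Hom C X' Y'"
  shows "Zero C X Y \<star> h = Zero C (X \<boxtimes> X') (Y \<boxtimes> Y')"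
  using Add_idem_Zero[OF tensor_hom[OF Zero_in_Hom[OF assms(1,2)] assms(3)]]
    tensor_add_left[OF Zero_in_Hom[OF assms(1,2)] Zero_in_Hom[OF assms(1,2)] assms(3)]
    Add_Zero(1)[OF Zero_in_Hom[OF assms(1,2)]] by simp

lemma tensor_in_Arr:
  assumes "f \<in> Arr C" "g \<in> Arr C"
  shows "f \<star> g \<in> Arr C" "Dom C (f \<star> g) = Dom C f \<boxtimes> Dom C g" "Cod C (f \<star> g) = Cod C f \<boxtimes> Cod C g"
  using tensor_hom[of f "Dom C f" "Cod C f" g "Dom C g" "Cod C g"] assms by (auto simp: Hom_def)

lemma Assoc_in_Arr:
  assumes "X \<in> Obj C" "Y \<in> Obj C" "Z \<in> Obj C"
  shows "Assoc C X Y Z \<in> Arr C" "Dom C (Assoc C X Y Z) = (X \<boxtimes> Y) \<boxtimes> Z"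
    "Cod C (Assoc C X Y Z) = X \<boxtimes> (Y \<boxtimes> Z)"
    "inv_arr C (Assoc C X Y Z) \<in> Arr C" "Cod C (inv_arr C (Assoc C X Y Z)) = (X \<boxtimes> Y) \<boxtimes> Z"
    "Dom C (inv_arr C (Assoc C X Y Z)) = X \<boxtimes> (Y \<boxtimes> Z)"
    "Assoc C X Y Z \<cdot> inv_arr C (Assoc C X Y Z) = Id C (X \<boxtimes> (Y \<boxtimes> Z))"
    "inv_arr C (Assoc C X Y Z) \<cdot> Assoc C X Y Z = Id C ((X \<boxtimes> Y) \<boxtimes> Z)"
  using assoc_hom[OF assms] inv_arr_inverse[OF assoc_iso[OF assms] assoc_hom[OF assms]]
  by (auto simp: Hom_def)

lemma unitors_in_Arr:
  assumes "X \<in> Obj C"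
  shows "LUnit C X \<in> Arr C" "Dom C (LUnit C X) = Unit C \<boxtimes> X" "Cod C (LUnit C X) = X"
    "RUnit C X \<in> Arr C" "Dom C (RUnit C X) = X \<boxtimes> Unit C" "Cod C (RUnit C X) = X"
  using lunit_hom[OF assms] runit_hom[OF assms] by (auto simp: Hom_def)

lemmas in_Arr = comp_in_Arr Id_in_Arr tensor_in_Arr Assoc_in_Arr unitors_in_Arr
  tensor_obj unit_obj comp_Id_Arr

text \<open>
  The axioms are restated with domains and codomains as side conditions, which the simplifier can
  compute; membership in a hom set would leave the intermediate objects to be guessed.
\<close>
lemma tensor_comp_Arr:
  assumes "f \<in> Arr C" "g \<in> Arr C" "f' \<in> Arr C" "g' \<in> Arr C" "Cod C f = Dom C g" "Cod C f' = Dom C g'"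
  shows "(g \<cdot> f) \<star> (g' \<cdot> f') = (g \<star> g') \<cdot> (f \<star> f')"
  using tensor_comp[of f "Dom C f" "Cod C f" g "Cod C g" f' "Dom C f'" "Cod C f'" g' "Cod C g'"] assms
  by (simp add: Hom_def)

lemma assoc_natural_Arr:
  assumes "f \<in> Arr C" "g \<in> Arr C" "h \<in> Arr C"
  shows "Assoc C (Cod C f) (Cod C g) (Cod C h) \<cdot> ((f \<star> g) \<star> h) =
    (f \<star> (g \<star> h)) \<cdot> Assoc C (Dom C f) (Dom C g) (Dom C h)"
  using assoc_natural[of f _ _ g _ _ h] assms by (simp add: Hom_def)

lemma is_iso_tensor:
  assumes "is_iso C f" "f \<in> Hom C X Y" "is_iso C g" "g \<in> Hom C X' Y'"
  shows "is_iso C (f \<star> g)"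
proof -
  note f = inv_arr_inverse[OF assms(1,2)] and g = inv_arr_inverse[OF assms(3,4)]
  have obj: "X \<in> Obj C" "Y \<in> Obj C" "X' \<in> Obj C" "Y' \<in> Obj C" using Hom_obj assms by blast+
  show ?thesis
    by (rule is_isoI[OF tensor_hom[OF assms(2,4)] tensor_hom[OF f(1) g(1)]])
      (simp_all add: f g obj tensor_id flip: tensor_comp[OF assms(2) f(1) assms(4) g(1)]
        tensor_comp[OF f(1) assms(2) g(1) assms(4)])
qed

lemma tensor_Unit_Zero:
  assumes "f \<in> Hom C X Y" "f \<star> Id C (Unit C) = Zero C (X \<boxtimes> Unit C) (Y \<boxtimes> Unit C)"
  shows "f = Zero C X Y"
proof -
  have obj: "X \<in> Obj C" "Y \<in> Obj C" using Hom_obj assms by blast+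
  then have "f \<cdot> RUnit C X = Zero C (X \<boxtimes> Unit C) Y"
    using runit_natural[OF assms(1)] assms(2) comp_Zero_right[OF runit_hom] tensor_obj unit_obj by metis
  then show ?thesis using comp_iso_Zero[OF runit_iso runit_hom assms(1)] obj by blast
qed

text \<open>
  One half of Frobenius reciprocity, reduced to nonvanishing.  The transpose
  \<open>g = (f \<otimes> 1) a\<^sup>-\<^sup>1 (1 \<otimes> coev)\<close> of \<open>f\<close> determines \<open>f \<otimes> 1\<close> up to an isomorphism \<open>w\<close>, as
  the first zigzag identity shows.  Indeed the right unitor of \<open>Y\<close>
  gives an isomorphism \<open>r\<close> from \<open>(A \<otimes> Y) \<otimes> 1\<close> to \<open>A \<otimes> Y\<close>, and the pentagon, the zigzag and the
  triangle identity together make \<open>r \<cdot> w\<close> the right unitor of \<open>A\<close> tensored with \<open>Y\<close>.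
\<close>
lemma left_dual_transpose:
  assumes dual: "left_dual C Y Y'" and A: "A \<in> Obj C" and B: "B \<in> Obj C"
    and "linked C (A \<boxtimes> Y) B"
  shows "linked C A (B \<boxtimes> Y')"
proof -
  let ?I = "Unit C" and ?a = "Assoc C" and ?a' = "\<lambda>X Y Z. inv_arr C (Assoc C X Y Z)"
  obtain f where f: "f \<in> Hom C (A \<boxtimes> Y) B" "f \<noteq> Zero C (A \<boxtimes> Y) B"
    using assms(4) by (auto simp: linked_def)
  obtain ev c where obj[simp]: "Y \<in> Obj C" "Y' \<in> Obj C"
    and ev: "ev \<in> Hom C (Y' \<boxtimes> Y) ?I" and c: "c \<in> Hom C ?I (Y \<boxtimes> Y')"
    and zigzag: "RUnit C Y \<cdot> (Id C Y \<star> ev) \<cdot> ?a Y Y' Y \<cdot> (c \<star> Id C Y) = LUnit C Y"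
    using dual by (auto simp: left_dual_def)
  note [simp] = in_Arr A B
  have [simp]: "f \<in> Arr C" "Dom C f = A \<boxtimes> Y" "Cod C f = B" "ev \<in> Arr C" "Dom C ev = Y' \<boxtimes> Y"
    "Cod C ev = ?I" "c \<in> Arr C" "Dom C c = ?I" "Cod C c = Y \<boxtimes> Y'"
    using f ev c by (auto simp: Hom_def)
  \<comment> \<open>\<open>(f \<otimes> 1) \<cdot> w\<close> factors through \<open>g \<otimes> 1\<close>\<close>
  define s where "s = ?a' A Y Y' \<cdot> (Id C A \<star> c)"
  define g where "g = (f \<star> Id C Y') \<cdot> s"
  define w where "w = (Id C (A \<boxtimes> Y) \<star> ev) \<cdot> (?a (A \<boxtimes> Y) Y' Y \<cdot> (s \<star> Id C Y))"
  define r where "r = (Id C A \<star> RUnit C Y) \<cdot> ?a A Y ?I"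
  have s[simp]: "s \<in> Arr C" "Dom C s = A \<boxtimes> ?I" "Cod C s = (A \<boxtimes> Y) \<boxtimes> Y'"
    by (auto simp: s_def)
  have w: "w \<in> Hom C ((A \<boxtimes> ?I) \<boxtimes> Y) ((A \<boxtimes> Y) \<boxtimes> ?I)" by (simp add: w_def Hom_def)
  have r: "r \<in> Hom C ((A \<boxtimes> Y) \<boxtimes> ?I) (A \<boxtimes> Y)" by (simp add: r_def Hom_def)
  have g: "g \<in> Hom C (A \<boxtimes> ?I) (B \<boxtimes> Y')" by (simp add: g_def Hom_def)
  have e1: "?a A Y ?I \<cdot> (Id C (A \<boxtimes> Y) \<star> ev) = (Id C A \<star> (Id C Y \<star> ev)) \<cdot> ?a A Y (Y' \<boxtimes> Y)"
    using assoc_natural_Arr[of "Id C A" "Id C Y" ev] by (simp add: tensor_id)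
  have e2: "?a A Y (Y' \<boxtimes> Y) \<cdot> ?a (A \<boxtimes> Y) Y' Y =
      (Id C A \<star> ?a Y Y' Y) \<cdot> (?a A (Y \<boxtimes> Y') Y \<cdot> (?a A Y Y' \<star> Id C Y))"
    using pentagon[of A Y Y' Y] by simp
  have "?a A Y Y' \<cdot> s = Id C A \<star> c"
    by (simp add: s_def flip: comp_assoc_Arr)
      (metis comp_Id_Arr(2) in_Arr(8) tensor_in_Arr Id_in_Arr A \<open>c \<in> Arr C\<close> \<open>Cod C c = Y \<boxtimes> Y'\<close>)
  then have e3: "(?a A Y Y' \<star> Id C Y) \<cdot> (s \<star> Id C Y) = (Id C A \<star> c) \<star> Id C Y"
    using tensor_comp_Arr[of s "?a A Y Y'" "Id C Y" "Id C Y"] comp_Id_Arr(1)[of "Id C Y"] by simp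
  have e4: "?a A (Y \<boxtimes> Y') Y \<cdot> ((Id C A \<star> c) \<star> Id C Y) = (Id C A \<star> (c \<star> Id C Y)) \<cdot> ?a A ?I Y"
    using assoc_natural_Arr[of "Id C A" c "Id C Y"] by simp
  have IA: "Id C A = Id C A \<cdot> Id C A" using comp_Id_Arr(1)[of "Id C A"] by simp
  have "(Id C A \<star> RUnit C Y) \<cdot> ((Id C A \<star> (Id C Y \<star> ev)) \<cdot> ((Id C A \<star> ?a Y Y' Y) \<cdot> (Id C A \<star> (c \<star> Id C Y))))
    = Id C A \<star> (RUnit C Y \<cdot> ((Id C Y \<star> ev) \<cdot> (?a Y Y' Y \<cdot> (c \<star> Id C Y))))"
    using tensor_comp_Arr[of "Id C A" "Id C A"] IA[symmetric] by simp
  then have e5: "(Id C A \<star> RUnit C Y) \<cdot> ((Id C A \<star> (Id C Y \<star> ev)) \<cdot> ((Id C A \<star> ?a Y Y' Y) \<cdot> (Id C A \<star> (c \<star> Id C Y))))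
    = Id C A \<star> LUnit C Y"
    using zigzag by simp
  have "r \<cdot> w = (Id C A \<star> RUnit C Y) \<cdot> ((?a A Y ?I \<cdot> (Id C (A \<boxtimes> Y) \<star> ev)) \<cdot> (?a (A \<boxtimes> Y) Y' Y \<cdot> (s \<star> Id C Y)))"
    by (simp add: r_def w_def comp_assoc_Arr)
  also have "\<dots> = (Id C A \<star> RUnit C Y) \<cdot> ((Id C A \<star> (Id C Y \<star> ev)) \<cdot> ((?a A Y (Y' \<boxtimes> Y) \<cdot> ?a (A \<boxtimes> Y) Y' Y) \<cdot> (s \<star> Id C Y)))"
    unfolding e1 by (simp add: comp_assoc_Arr)
  also have "\<dots> = (Id C A \<star> RUnit C Y) \<cdot> ((Id C A \<star> (Id C Y \<star> ev)) \<cdot> ((Id C A \<star> ?a Y Y' Y) \<cdot>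
      (?a A (Y \<boxtimes> Y') Y \<cdot> ((?a A Y Y' \<star> Id C Y) \<cdot> (s \<star> Id C Y)))))"
    unfolding e2 by (simp add: comp_assoc_Arr)
  also have "\<dots> = ((Id C A \<star> RUnit C Y) \<cdot> ((Id C A \<star> (Id C Y \<star> ev)) \<cdot> ((Id C A \<star> ?a Y Y' Y) \<cdot>
      (Id C A \<star> (c \<star> Id C Y))))) \<cdot> ?a A ?I Y"
    unfolding e3 e4 by (simp add: comp_assoc_Arr)
  also have "\<dots> = RUnit C A \<star> Id C Y"
    unfolding e5 using triangle by simp
  finally have rw: "r \<cdot> w = RUnit C A \<star> Id C Y" .
  have "is_iso C r"
    unfolding r_def
    by (rule is_iso_comp[OF assoc_iso assoc_hom is_iso_tensor[OF is_iso_Id id_hom runit_iso runit_hom]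
          tensor_hom[OF id_hom runit_hom]]) simp_all
  moreover have "is_iso C (r \<cdot> w)"
    unfolding rw by (rule is_iso_tensor[OF runit_iso runit_hom is_iso_Id id_hom]) simp_all
  ultimately have "is_iso C w" using is_iso_right_factor[OF w _ r] by blast
  have "g \<noteq> Zero C (A \<boxtimes> ?I) (B \<boxtimes> Y')"
  proof
    assume g0: "g = Zero C (A \<boxtimes> ?I) (B \<boxtimes> Y')"
    have i1: "(f \<star> Id C ?I) \<cdot> (Id C (A \<boxtimes> Y) \<star> ev) = (Id C B \<star> ev) \<cdot> (f \<star> Id C (Y' \<boxtimes> Y))"
      using tensor_comp_Arr[of "Id C (A \<boxtimes> Y)" f ev "Id C ?I"] tensor_comp_Arr[of f "Id C B" "Id C (Y' \<boxtimes> Y)" ev]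
        comp_Id_Arr[of f] comp_Id_Arr[of ev] by simp
    have i2: "(f \<star> Id C (Y' \<boxtimes> Y)) \<cdot> ?a (A \<boxtimes> Y) Y' Y = ?a B Y' Y \<cdot> ((f \<star> Id C Y') \<star> Id C Y)"
      using assoc_natural_Arr[of f "Id C Y'" "Id C Y"] by (simp add: tensor_id)
    have i3: "((f \<star> Id C Y') \<star> Id C Y) \<cdot> (s \<star> Id C Y) = g \<star> Id C Y"
      using tensor_comp_Arr[of s "f \<star> Id C Y'" "Id C Y" "Id C Y"] comp_Id_Arr(1)[of "Id C Y"]
      by (simp add: g_def)
    have "(f \<star> Id C ?I) \<cdot> w = ((f \<star> Id C ?I) \<cdot> (Id C (A \<boxtimes> Y) \<star> ev)) \<cdot> (?a (A \<boxtimes> Y) Y' Y \<cdot> (s \<star> Id C Y))"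
      by (simp add: w_def comp_assoc_Arr)
    also have "\<dots> = (Id C B \<star> ev) \<cdot> (((f \<star> Id C (Y' \<boxtimes> Y)) \<cdot> ?a (A \<boxtimes> Y) Y' Y) \<cdot> (s \<star> Id C Y))"
      unfolding i1 by (simp add: comp_assoc_Arr)
    also have "\<dots> = (Id C B \<star> ev) \<cdot> (?a B Y' Y \<cdot> (g \<star> Id C Y))"
      unfolding i2 using i3 by (simp add: comp_assoc_Arr)
    also have "\<dots> = Zero C ((A \<boxtimes> ?I) \<boxtimes> Y) (B \<boxtimes> ?I)"
      using g0 tensor_Zero_left[OF _ _ id_hom, of "A \<boxtimes> ?I" "B \<boxtimes> Y'" Y]
        comp_Zero_right[of "?a B Y' Y" "(B \<boxtimes> Y') \<boxtimes> Y" "B \<boxtimes> (Y' \<boxtimes> Y)" "(A \<boxtimes> ?I) \<boxtimes> Y"]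
        comp_Zero_right[of "Id C B \<star> ev" "B \<boxtimes> (Y' \<boxtimes> Y)" "B \<boxtimes> ?I" "(A \<boxtimes> ?I) \<boxtimes> Y"]
      by (simp add: Hom_def)
    finally have "f \<star> Id C ?I = Zero C ((A \<boxtimes> Y) \<boxtimes> ?I) (B \<boxtimes> ?I)"
      using comp_iso_Zero[OF \<open>is_iso C w\<close> w, of "f \<star> Id C ?I" "B \<boxtimes> ?I"] by (simp add: Hom_def)
    then show False using tensor_Unit_Zero[OF f(1)] f(2) by blast
  qed
  then have "linked C (A \<boxtimes> ?I) (B \<boxtimes> Y')" using g by (auto simp: linked_def)
  then show ?thesis using linked_comp_iso_right[OF runit_iso runit_hom] A by blast
qed

text \<open>The other half of Frobenius reciprocity, by the second zigzag identity.\<close>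
lemma left_dual_untranspose:
  assumes dual: "left_dual C Y Y'" and A: "A \<in> Obj C" and B: "B \<in> Obj C"
    and "linked C A (B \<boxtimes> Y')"
  shows "linked C (A \<boxtimes> Y) B"
proof -
  let ?I = "Unit C" and ?a = "Assoc C" and ?a' = "\<lambda>X Y Z. inv_arr C (Assoc C X Y Z)"
  obtain g where g: "g \<in> Hom C A (B \<boxtimes> Y')" "g \<noteq> Zero C A (B \<boxtimes> Y')"
    using assms(4) by (auto simp: linked_def)
  obtain ev c where obj[simp]: "Y \<in> Obj C" "Y' \<in> Obj C"
    and ev: "ev \<in> Hom C (Y' \<boxtimes> Y) ?I" and c: "c \<in> Hom C ?I (Y \<boxtimes> Y')"
    and zigzag: "LUnit C Y' \<cdot> (ev \<star> Id C Y') \<cdot> ?a' Y' Y Y' \<cdot> (Id C Y' \<star> c) = RUnit C Y'"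
    using dual by (auto simp: left_dual_def)
  note [simp] = in_Arr A B
  have [simp]: "g \<in> Arr C" "Dom C g = A" "Cod C g = B \<boxtimes> Y'" "ev \<in> Arr C" "Dom C ev = Y' \<boxtimes> Y"
    "Cod C ev = ?I" "c \<in> Arr C" "Dom C c = ?I" "Cod C c = Y \<boxtimes> Y'"
    using g ev c by (auto simp: Hom_def)
  \<comment> \<open>\<open>q \<cdot> u\<close> is invertible, and \<open>u \<cdot> (g \<otimes> 1)\<close> factors through \<open>f \<otimes> 1\<close>\<close>
  define v where "v = (Id C B \<star> ev) \<cdot> ?a B Y' Y"
  define f where "f = v \<cdot> (g \<star> Id C Y)"
  define u where "u = (v \<star> Id C Y') \<cdot> (?a' (B \<boxtimes> Y') Y Y' \<cdot> (Id C (B \<boxtimes> Y') \<star> c))"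
  define q where "q = (Id C B \<star> LUnit C Y') \<cdot> ?a B ?I Y'"
  have v[simp]: "v \<in> Arr C" "Dom C v = (B \<boxtimes> Y') \<boxtimes> Y" "Cod C v = B \<boxtimes> ?I"
    by (auto simp: v_def)
  have u: "u \<in> Hom C ((B \<boxtimes> Y') \<boxtimes> ?I) ((B \<boxtimes> ?I) \<boxtimes> Y')" by (simp add: u_def Hom_def)
  have q: "q \<in> Hom C ((B \<boxtimes> ?I) \<boxtimes> Y') (B \<boxtimes> Y')" by (simp add: q_def Hom_def)
  have f: "f \<in> Hom C (A \<boxtimes> Y) (B \<boxtimes> ?I)" by (simp add: f_def Hom_def)
  have IB: "Id C B \<cdot> Id C B = Id C B" using comp_Id_Arr(1)[of "Id C B"] by simp
  have IY: "Id C Y' \<cdot> Id C Y' = Id C Y'" using comp_Id_Arr(1)[of "Id C Y'"] by simp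
  have e0: "v \<star> Id C Y' = ((Id C B \<star> ev) \<star> Id C Y') \<cdot> (?a B Y' Y \<star> Id C Y')"
    using tensor_comp_Arr[of "?a B Y' Y" "Id C B \<star> ev" "Id C Y'" "Id C Y'"] IY by (simp add: v_def)
  have e1: "?a B ?I Y' \<cdot> ((Id C B \<star> ev) \<star> Id C Y') = (Id C B \<star> (ev \<star> Id C Y')) \<cdot> ?a B (Y' \<boxtimes> Y) Y'"
    using assoc_natural_Arr[of "Id C B" ev "Id C Y'"] by simp
  have e2: "?a B (Y' \<boxtimes> Y) Y' \<cdot> ((?a B Y' Y \<star> Id C Y') \<cdot> ?a' (B \<boxtimes> Y') Y Y') =
      (Id C B \<star> ?a' Y' Y Y') \<cdot> ?a B Y' (Y \<boxtimes> Y')" (is "?x = ?y")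
  proof -
    have "(Id C B \<star> ?a' Y' Y Y') \<cdot> (Id C B \<star> ?a Y' Y Y') = Id C (B \<boxtimes> ((Y' \<boxtimes> Y) \<boxtimes> Y'))"
      using tensor_comp_Arr[of "Id C B" "Id C B" "?a Y' Y Y'" "?a' Y' Y Y'"] IB by (simp add: tensor_id)
    then have "?x = ((Id C B \<star> ?a' Y' Y Y') \<cdot> (Id C B \<star> ?a Y' Y Y')) \<cdot> ?x"
      using comp_Id_Arr(2)[of ?x] by simp
    also have "\<dots> = (Id C B \<star> ?a' Y' Y Y') \<cdot>
        (((Id C B \<star> ?a Y' Y Y') \<cdot> (?a B (Y' \<boxtimes> Y) Y' \<cdot> (?a B Y' Y \<star> Id C Y'))) \<cdot> ?a' (B \<boxtimes> Y') Y Y')"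
      by (simp add: comp_assoc_Arr)
    also have "\<dots> = (Id C B \<star> ?a' Y' Y Y') \<cdot>
        ((?a B Y' (Y \<boxtimes> Y') \<cdot> ?a (B \<boxtimes> Y') Y Y') \<cdot> ?a' (B \<boxtimes> Y') Y Y')"
      using pentagon[of B Y' Y Y'] by simp
    also have "\<dots> = (Id C B \<star> ?a' Y' Y Y') \<cdot> (?a B Y' (Y \<boxtimes> Y') \<cdot>
        Id C ((B \<boxtimes> Y') \<boxtimes> (Y \<boxtimes> Y')))"
      by (simp add: comp_assoc_Arr)
    also have "\<dots> = ?y" using comp_Id_Arr(1)[of "?a B Y' (Y \<boxtimes> Y')"] by simp
    finally show ?thesis .
  qed
  have e3: "?a B Y' (Y \<boxtimes> Y') \<cdot> (Id C (B \<boxtimes> Y') \<star> c) = (Id C B \<star> (Id C Y' \<star> c)) \<cdot> ?a B Y' ?I"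
    using assoc_natural_Arr[of "Id C B" "Id C Y'" c] by (simp add: tensor_id)
  have "(Id C B \<star> LUnit C Y') \<cdot> ((Id C B \<star> (ev \<star> Id C Y')) \<cdot> ((Id C B \<star> ?a' Y' Y Y') \<cdot> (Id C B \<star> (Id C Y' \<star> c))))
    = Id C B \<star> (LUnit C Y' \<cdot> ((ev \<star> Id C Y') \<cdot> (?a' Y' Y Y' \<cdot> (Id C Y' \<star> c))))"
    using tensor_comp_Arr[of "Id C B" "Id C B"] IB by simp
  then have e4: "(Id C B \<star> LUnit C Y') \<cdot> ((Id C B \<star> (ev \<star> Id C Y')) \<cdot> ((Id C B \<star> ?a' Y' Y Y') \<cdot> (Id C B \<star> (Id C Y' \<star> c))))
    = Id C B \<star> RUnit C Y'"
    using zigzag by simp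
  have "q \<cdot> u = (Id C B \<star> LUnit C Y') \<cdot> ((?a B ?I Y' \<cdot> ((Id C B \<star> ev) \<star> Id C Y')) \<cdot>
      ((?a B Y' Y \<star> Id C Y') \<cdot> (?a' (B \<boxtimes> Y') Y Y' \<cdot> (Id C (B \<boxtimes> Y') \<star> c))))"
    by (simp add: q_def u_def e0 comp_assoc_Arr)
  also have "\<dots> = (Id C B \<star> LUnit C Y') \<cdot> ((Id C B \<star> (ev \<star> Id C Y')) \<cdot>
      ((?a B (Y' \<boxtimes> Y) Y' \<cdot> ((?a B Y' Y \<star> Id C Y') \<cdot> ?a' (B \<boxtimes> Y') Y Y')) \<cdot> (Id C (B \<boxtimes> Y') \<star> c)))"
    unfolding e1 by (simp add: comp_assoc_Arr)
  also have "\<dots> = (Id C B \<star> LUnit C Y') \<cdot> ((Id C B \<star> (ev \<star> Id C Y')) \<cdot>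
      ((Id C B \<star> ?a' Y' Y Y') \<cdot> (?a B Y' (Y \<boxtimes> Y') \<cdot> (Id C (B \<boxtimes> Y') \<star> c))))"
    unfolding e2 by (simp add: comp_assoc_Arr)
  also have "\<dots> = ((Id C B \<star> LUnit C Y') \<cdot> ((Id C B \<star> (ev \<star> Id C Y')) \<cdot>
      ((Id C B \<star> ?a' Y' Y Y') \<cdot> (Id C B \<star> (Id C Y' \<star> c))))) \<cdot> ?a B Y' ?I"
    unfolding e3 by (simp add: comp_assoc_Arr)
  finally have qu: "q \<cdot> u = (Id C B \<star> RUnit C Y') \<cdot> ?a B Y' ?I" unfolding e4 .
  have qu_iso: "is_iso C (q \<cdot> u)"
    unfolding qu
    by (rule is_iso_comp[OF assoc_iso assoc_hom is_iso_tensor[OF is_iso_Id id_hom runit_iso runit_hom]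
          tensor_hom[OF id_hom runit_hom]]) simp_all
  have "f \<noteq> Zero C (A \<boxtimes> Y) (B \<boxtimes> ?I)"
  proof
    assume f0: "f = Zero C (A \<boxtimes> Y) (B \<boxtimes> ?I)"
    have i1: "(Id C (B \<boxtimes> Y') \<star> c) \<cdot> (g \<star> Id C ?I) = (g \<star> Id C (Y \<boxtimes> Y')) \<cdot> (Id C A \<star> c)"
      using tensor_comp_Arr[of g "Id C (B \<boxtimes> Y')" "Id C ?I" c] tensor_comp_Arr[of "Id C A" g c "Id C (Y \<boxtimes> Y')"]
        comp_Id_Arr[of g] comp_Id_Arr[of c] by simp
    have i2: "?a' (B \<boxtimes> Y') Y Y' \<cdot> (g \<star> Id C (Y \<boxtimes> Y')) = ((g \<star> Id C Y) \<star> Id C Y') \<cdot> ?a' A Y Y'" (is "?x = ?y")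
    proof -
      have "?x = ?x \<cdot> (?a A Y Y' \<cdot> ?a' A Y Y')" using comp_Id_Arr(1)[of ?x] by simp
      also have "\<dots> = ?a' (B \<boxtimes> Y') Y Y' \<cdot> (((g \<star> Id C (Y \<boxtimes> Y')) \<cdot> ?a A Y Y') \<cdot> ?a' A Y Y')"
        by (simp add: comp_assoc_Arr del: Assoc_in_Arr(7,8))
      also have "\<dots> = ?a' (B \<boxtimes> Y') Y Y' \<cdot> ((?a (B \<boxtimes> Y') Y Y' \<cdot> ((g \<star> Id C Y) \<star> Id C Y')) \<cdot> ?a' A Y Y')"
        using assoc_natural_Arr[of g "Id C Y" "Id C Y'"] by (simp add: tensor_id)
      also have "\<dots> = (?a' (B \<boxtimes> Y') Y Y' \<cdot> ?a (B \<boxtimes> Y') Y Y') \<cdot> ?y"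
        by (simp add: comp_assoc_Arr del: Assoc_in_Arr(7,8))
      also have "\<dots> = ?y" using comp_Id_Arr(2)[of ?y] by simp
      finally show ?thesis .
    qed
    have i3: "(v \<star> Id C Y') \<cdot> ((g \<star> Id C Y) \<star> Id C Y') = f \<star> Id C Y'"
      using tensor_comp_Arr[of "g \<star> Id C Y" v "Id C Y'" "Id C Y'"] IY by (simp add: f_def)
    have farr: "f \<in> Arr C" "Dom C f = A \<boxtimes> Y" "Cod C f = B \<boxtimes> ?I" using f by (auto simp: Hom_def)
    have "u \<cdot> (g \<star> Id C ?I) = (v \<star> Id C Y') \<cdot> (?a' (B \<boxtimes> Y') Y Y' \<cdot> ((Id C (B \<boxtimes> Y') \<star> c) \<cdot> (g \<star> Id C ?I)))"
      by (simp add: u_def comp_assoc_Arr)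
    also have "\<dots> = (v \<star> Id C Y') \<cdot> ((?a' (B \<boxtimes> Y') Y Y' \<cdot> (g \<star> Id C (Y \<boxtimes> Y'))) \<cdot> (Id C A \<star> c))"
      unfolding i1 by (simp add: comp_assoc_Arr)
    also have "\<dots> = ((v \<star> Id C Y') \<cdot> ((g \<star> Id C Y) \<star> Id C Y')) \<cdot> (?a' A Y Y' \<cdot> (Id C A \<star> c))"
      unfolding i2 by (simp add: comp_assoc_Arr)
    also have "\<dots> = (f \<star> Id C Y') \<cdot> (?a' A Y Y' \<cdot> (Id C A \<star> c))" unfolding i3 ..
    also have "\<dots> = Zero C (A \<boxtimes> ?I) ((B \<boxtimes> ?I) \<boxtimes> Y')"
      using f0 tensor_Zero_left[OF _ _ id_hom, of "A \<boxtimes> Y" "B \<boxtimes> ?I" Y']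
        comp_Zero_left[of "?a' A Y Y' \<cdot> (Id C A \<star> c)" "A \<boxtimes> ?I" "(A \<boxtimes> Y) \<boxtimes> Y'" "(B \<boxtimes> ?I) \<boxtimes> Y'"]
      by (simp add: Hom_def)
    finally have "q \<cdot> (u \<cdot> (g \<star> Id C ?I)) = Zero C (A \<boxtimes> ?I) (B \<boxtimes> Y')"
      using comp_Zero_right[OF q] by simp
    moreover have gI: "g \<star> Id C ?I \<in> Hom C (A \<boxtimes> ?I) ((B \<boxtimes> Y') \<boxtimes> ?I)" by (simp add: Hom_def)
    ultimately have "(q \<cdot> u) \<cdot> (g \<star> Id C ?I) = Zero C (A \<boxtimes> ?I) (B \<boxtimes> Y')"
      using comp_assoc[OF gI u q] by simp
    then have "g \<star> Id C ?I = Zero C (A \<boxtimes> ?I) ((B \<boxtimes> Y') \<boxtimes> ?I)"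
      using iso_comp_Zero[OF qu_iso comp_hom[OF u q] gI] by blast
    then show False using tensor_Unit_Zero[OF g(1)] g(2) by blast
  qed
  then have "linked C (A \<boxtimes> Y) (B \<boxtimes> ?I)" using f by (auto simp: linked_def)
  then show ?thesis using linked_comp_iso_left[OF runit_iso runit_hom] B by blast
qed

end

section \<open>Simple constituents in a fusion category\<close>

context fusion_category
begin

text \<open>
  Decompose \<open>Y\<close> into simple objects.  Some projection \<open>p\<close> has \<open>p \<cdot> f \<noteq> 0\<close>, and by Schur's lemma
  this composite is invertible.
\<close>
lemma simple_subobject_splits:
  assumes S: "simple_object C S" and f: "f \<in> Hom C S Y" "f \<noteq> Zero C S Y"
  obtains p where "p \<in> Hom C Y S" "p \<cdot> f = Id C S"
proof -
  have Y: "Y \<in> Obj C" and SO: "S \<in> Obj C" using Hom_obj f by blast+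
  obtain Ts where Ts: "\<forall>T \<in> set Ts. simple_object C T" "direct_sum C Y Ts"
    using semisimple Y by blast
  have "\<exists>T p. simple_object C T \<and> p \<in> Hom C Y T \<and> p \<cdot> f \<noteq> Zero C S T"
  proof (rule ccontr)
    assume none: "\<not> ?thesis"
    have "Id C Y \<cdot> f = Zero C S Y"
    proof (rule direct_sum_Id_induct[OF Ts(2)])
      show "Zero C Y Y \<cdot> f = Zero C S Y" using comp_Zero_left[OF f(1) Y] .
      show "Add C g h \<cdot> f = Zero C S Y"
        if "g \<in> Hom C Y Y" "h \<in> Hom C Y Y" "g \<cdot> f = Zero C S Y" "h \<cdot> f = Zero C S Y" for g h
        using comp_add_left[OF f(1) that(1,2)] that Add_Zero[OF Zero_in_Hom[OF SO Y]] by simp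
      show "(i \<cdot> p) \<cdot> f = Zero C S Y"
        if "T \<in> set Ts" "i \<in> Hom C T Y" "p \<in> Hom C Y T" for T i p
      proof -
        have "p \<cdot> f = Zero C S T" using none that Ts(1) by blast
        then show ?thesis using comp_assoc[OF f(1) that(3,2)] comp_Zero_right[OF that(2) SO] by simp
      qed
    qed
    then show False using comp_id_left f by simp
  qed
  then obtain T p where T: "simple_object C T" and p: "p \<in> Hom C Y T" "p \<cdot> f \<noteq> Zero C S T" by blast
  have pf: "p \<cdot> f \<in> Hom C S T" using comp_hom f p by blast
  have "is_iso C (p \<cdot> f)" using schur_is_iso[OF S T pf p(2)] .
  then obtain g where g: "g \<in> Hom C T S" "g \<cdot> (p \<cdot> f) = Id C S" using inverse_arrowsE[OF _ pf] by blast
  show ?thesis using that[OF comp_hom[OF p(1) g(1)]] comp_assoc[OF f(1) p(1) g(1)] g(2) by simp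
qed

lemma linked_simple_constituent:
  assumes "linked C X Y"
  obtains S where "simple_object C S" "linked C S X" "linked C S Y"
proof -
  obtain f where f: "f \<in> Hom C X Y" "f \<noteq> Zero C X Y" using assms by (auto simp: linked_def)
  have X: "X \<in> Obj C" and Y: "Y \<in> Obj C" using Hom_obj f by blast+
  obtain Ss where Ss: "\<forall>S \<in> set Ss. simple_object C S" "direct_sum C X Ss"
    using semisimple X by blast
  obtain S i p where S: "S \<in> set Ss" "i \<in> Hom C S X" "p \<in> Hom C X S" "p \<cdot> i = Id C S"
    "f \<cdot> i \<noteq> Zero C S Y"
    using direct_sum_nonzero_summand[OF Ss(2) f] .
  have "i \<noteq> Zero C S X" using S(5) comp_Zero_right[OF f(1), of S] Hom_obj[OF S(2)] by auto
  then show ?thesis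
    using that[of S] Ss(1) S comp_hom[OF S(2) f(1)] unfolding linked_def by blast
qed

text \<open>Projecting \<open>X\<close> onto its direct summand \<open>S\<close> and including \<open>S\<close> into \<open>Y\<close> gives a nonzero morphism.\<close>
lemma linked_via_simple:
  assumes "simple_object C S" "linked C S X" "linked C S Y"
  shows "linked C X Y"
proof -
  obtain f g where f: "f \<in> Hom C S X" "f \<noteq> Zero C S X" and g: "g \<in> Hom C S Y" "g \<noteq> Zero C S Y"
    using assms by (auto simp: linked_def)
  obtain p where p: "p \<in> Hom C X S" "p \<cdot> f = Id C S" using simple_subobject_splits[OF assms(1) f] .
  have "(g \<cdot> p) \<cdot> f = g" using comp_assoc[OF f(1) p(1) g(1)] p(2) comp_id_right[OF g(1)] by simp
  then have "g \<cdot> p \<noteq> Zero C X Y" using comp_Zero_left[OF f(1), of Y] Hom_obj[OF g(1)] g(2) by auto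
  then show ?thesis using comp_hom[OF p(1) g(1)] by (auto simp: linked_def)
qed

lemma linked_sym: "linked C X Y \<Longrightarrow> linked C Y X"
  by (meson linked_simple_constituent linked_via_simple)

lemma linked_refl_simple: "simple_object C S \<Longrightarrow> linked C S S"
  using simple_object_Id id_hom by (auto simp: linked_def)

lemma linked_is_mono:
  assumes "simple_object C S" "linked C S X"
  obtains f where "is_mono C f" "f \<in> Hom C S X"
  using assms simple_nonzero_is_mono by (auto simp: linked_def)

text \<open>
  The chosen object depends only on the isomorphism class of \<open>X\<close>.  Working with representatives
  turns isomorphism of simple objects into equality (\<open>Irr_linked_eq\<close>), so that the set \<open>Irr\<close> of
  representatives is finite and the unit acts as an identity in the hypergroup.
\<close>
definition simple_rep :: "'o \<Rightarrow> 'o" where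
  "simple_rep X = (SOME Y. simple_object C Y \<and> linked C X Y)"

definition Irr :: "'o set" where
  "Irr = simple_rep ` {X. simple_object C X}"

definition fusion_product :: "'o \<Rightarrow> 'o \<Rightarrow> 'o set" where
  "fusion_product X Y = {S \<in> Irr. linked C S (X \<boxtimes> Y)}"

lemma simple_rep:
  assumes "simple_object C X"
  shows "simple_object C (simple_rep X)" "linked C X (simple_rep X)" "simple_rep X \<in> Irr"
  using someI[of "\<lambda>Y. simple_object C Y \<and> linked C X Y" X] assms linked_refl_simple[OF assms]
  by (auto simp: simple_rep_def Irr_def)

lemma simple_rep_eq:
  assumes "simple_object C X" "simple_object C Y" "linked C X Y"
  shows "simple_rep X = simple_rep Y"
proof -
  have "linked C X Z \<longleftrightarrow> linked C Y Z" for Z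
    using linked_via_simple[OF assms(1), of Y Z] linked_via_simple[OF assms(2), of X Z] assms(3) linked_sym
    by blast
  then show ?thesis by (simp add: simple_rep_def)
qed

lemma Irr_simple: "S \<in> Irr \<Longrightarrow> simple_object C S"
  by (auto simp: Irr_def simple_rep)

lemma Irr_obj: "S \<in> Irr \<Longrightarrow> S \<in> Obj C"
  using Irr_simple by (simp add: simple_object_def)

lemma simple_rep_Irr:
  assumes "S \<in> Irr"
  shows "simple_rep S = S"
proof -
  obtain X where X: "simple_object C X" and S: "S = simple_rep X" using assms by (auto simp: Irr_def)
  show ?thesis using simple_rep_eq[OF X simple_rep(1,2)[OF X]] S by simp
qed

lemma Irr_linked_eq: "\<lbrakk>S \<in> Irr; T \<in> Irr; linked C S T\<rbrakk> \<Longrightarrow> S = T"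
  using simple_rep_eq[of S T] Irr_simple[of S] Irr_simple[of T] simple_rep_Irr[of S] simple_rep_Irr[of T]
  by simp

lemma Irr_linked_simple_eq: "\<lbrakk>S \<in> Irr; simple_object C X; linked C S X\<rbrakk> \<Longrightarrow> S = simple_rep X"
  using simple_rep_eq[of S X] Irr_simple[of S] simple_rep_Irr[of S] by simp

lemma finite_Irr: "finite Irr"
proof -
  obtain F where F: "finite F" "\<forall>X. simple_object C X \<longrightarrow> (\<exists>Y \<in> F. isomorphic C X Y)"
    using finitely_many_simples by blast
  then obtain \<phi> where \<phi>: "\<And>X. X \<in> Irr \<Longrightarrow> \<phi> X \<in> F" "\<And>X. X \<in> Irr \<Longrightarrow> isomorphic C X (\<phi> X)"
    using Irr_simple by metis
  have "inj_on \<phi> Irr"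
  proof (rule inj_onI)
    fix X Y assume X: "X \<in> Irr" and Y: "Y \<in> Irr" and eq: "\<phi> X = \<phi> Y"
    obtain f where f: "f \<in> Hom C X (\<phi> X)" "is_iso C f" using \<phi>(2)[OF X] by (auto simp: isomorphic_def)
    obtain g where g: "g \<in> Hom C Y (\<phi> X)" "is_iso C g" using \<phi>(2)[OF Y] eq by (auto simp: isomorphic_def)
    have "linked C Y Y" using linked_refl_simple Irr_simple Y by blast
    then have "linked C (\<phi> X) Y" using linked_comp_iso_right[OF g(2,1)] by blast
    then have "linked C X Y" using linked_comp_iso_right[OF f(2,1)] by blast
    then show "X = Y" using Irr_linked_eq X Y by blast
  qed
  then show ?thesis using \<phi>(1) F(1) by (meson finite_imageD finite_subset image_subsetI)
qed

lemma linked_Irr_constituent: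
  assumes "linked C X Y"
  obtains S where "S \<in> Irr" "linked C S X" "linked C S Y"
proof -
  obtain T where T: "simple_object C T" "linked C T X" "linked C T Y"
    using linked_simple_constituent[OF assms] .
  then show ?thesis
    using that[of "simple_rep T"] simple_rep[OF T(1)] linked_via_simple linked_sym by blast
qed

lemma linked_transpose:
  assumes "left_dual C Y Y'" "X \<in> Obj C" "Z \<in> Obj C"
  shows "linked C Z (X \<boxtimes> Y) \<longleftrightarrow> linked C X (Z \<boxtimes> Y')"
  using left_dual_transpose[OF assms] left_dual_untranspose[OF assms] linked_sym by blast

text \<open>
  Transposing the second tensor factor to the other side turns this into the fact that two objects
  are linked exactly if they have a common simple constituent.
\<close>
lemma linked_tensor_iff:
  assumes "X \<in> Obj C" "Y \<in> Obj C" "Z \<in> Obj C"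
  shows "linked C Z (X \<boxtimes> Y) \<longleftrightarrow> (\<exists>Q \<in> Irr. linked C Q X \<and> linked C Z (Q \<boxtimes> Y))"
proof -
  obtain Y' where Y': "left_dual C Y Y'" using ex_left_dual assms by blast
  have "linked C X (Z \<boxtimes> Y') \<longleftrightarrow> (\<exists>Q \<in> Irr. linked C Q X \<and> linked C Q (Z \<boxtimes> Y'))"
    using linked_Irr_constituent linked_via_simple Irr_simple by metis
  then show ?thesis using linked_transpose[OF Y' _ assms(3)] assms(1) Irr_obj by blast
qed

lemma linked_Unit_tensor:
  assumes "X \<in> Obj C"
  shows "linked C Z (Unit C \<boxtimes> X) \<longleftrightarrow> linked C Z X"
  using linked_comp_iso_left[OF lunit_iso lunit_hom] assms by blast

lemma linked_assoc:
  assumes "X \<in> Obj C" "Y \<in> Obj C" "Z \<in> Obj C"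
  shows "linked C W ((X \<boxtimes> Y) \<boxtimes> Z) \<longleftrightarrow> linked C W (X \<boxtimes> (Y \<boxtimes> Z))"
  using linked_comp_iso_left[OF assoc_iso assoc_hom] assms by blast

lemma fusion_product_iff: "S \<in> fusion_product X Y \<longleftrightarrow> S \<in> Irr \<and> linked C S (X \<boxtimes> Y)"
  by (simp add: fusion_product_def)

lemma fusion_subcategoryD:
  assumes "fusion_subcategory C D"
  shows "D \<subseteq> Obj C" "Unit C \<in> D" "\<lbrakk>X \<in> D; Y \<in> D\<rbrakk> \<Longrightarrow> X \<boxtimes> Y \<in> D"
    "\<lbrakk>X \<in> D; Y \<in> D; biproduct C Z X Y\<rbrakk> \<Longrightarrow> Z \<in> D"
    "\<lbrakk>is_mono C f; f \<in> Hom C X Y; Y \<in> D\<rbrakk> \<Longrightarrow> X \<in> D"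
  using assms unfolding fusion_subcategory_def Hom_def by blast+

lemma fusion_subcategoryI:
  assumes "D \<subseteq> Obj C" "Unit C \<in> D" "\<And>X Y. \<lbrakk>X \<in> D; Y \<in> D\<rbrakk> \<Longrightarrow> X \<boxtimes> Y \<in> D"
    "\<And>X Y Z. \<lbrakk>X \<in> D; Y \<in> D; biproduct C Z X Y\<rbrakk> \<Longrightarrow> Z \<in> D"
    "\<And>f X Y. \<lbrakk>is_mono C f; f \<in> Hom C X Y; Y \<in> D\<rbrakk> \<Longrightarrow> X \<in> D"
  shows "fusion_subcategory C D"
proof -
  have "Dom C f \<in> D" if "is_mono C f" "Cod C f \<in> D" for f
  proof -
    have "f \<in> Hom C (Dom C f) (Cod C f)" using that(1) by (simp add: is_mono_def Hom_def)
    then show ?thesis using assms(5) that by blast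
  qed
  then show ?thesis using assms(1-4) unfolding fusion_subcategory_def by blast
qed

lemma fusion_subcategory_Obj: "fusion_subcategory C (Obj C)"
  by (rule fusion_subcategoryI) (auto simp: tensor_obj unit_obj biproduct_def dest: Hom_obj)

lemma fusion_subcategory_generated: "fusion_subcategory C (generated_fusion_subcategory C T)" if "T \<subseteq> Obj C"
proof -
  let ?G = "generated_fusion_subcategory C T"
  have le: "?G \<subseteq> D" if "fusion_subcategory C D" "T \<subseteq> D" for D
    using that by (auto simp: generated_fusion_subcategory_def)
  have ge: "X \<in> ?G" if "\<And>D. \<lbrakk>fusion_subcategory C D; T \<subseteq> D\<rbrakk> \<Longrightarrow> X \<in> D" for X
    using that by (simp add: generated_fusion_subcategory_def)
  show ?thesis
  proof (rule fusion_subcategoryI)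
    show "?G \<subseteq> Obj C" using le[OF fusion_subcategory_Obj that] .
    show "Unit C \<in> ?G" by (rule ge) (rule fusion_subcategoryD)
    show "X \<boxtimes> Y \<in> ?G" if "X \<in> ?G" "Y \<in> ?G" for X Y
      by (rule ge) (use that le fusion_subcategoryD(3) in blast)
    show "Z \<in> ?G" if "X \<in> ?G" "Y \<in> ?G" "biproduct C Z X Y" for X Y Z
      by (rule ge) (use that le fusion_subcategoryD(4) in blast)
    show "X \<in> ?G" if "is_mono C f" "f \<in> Hom C X Y" "Y \<in> ?G" for f X Y
      by (rule ge) (use that le fusion_subcategoryD(5) in blast)
  qed
qed

lemma subset_generated: "T \<subseteq> generated_fusion_subcategory C T"
  by (auto simp: generated_fusion_subcategory_def)

lemma generated_least: "\<lbrakk>fusion_subcategory C D; T \<subseteq> D\<rbrakk> \<Longrightarrow> generated_fusion_subcategory C T \<subseteq> D"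
  by (auto simp: generated_fusion_subcategory_def)

lemma fusion_subcategory_constituent:
  assumes "fusion_subcategory C D" "X \<in> D" "simple_object C S" "linked C S X"
  shows "S \<in> D"
proof -
  obtain f where "is_mono C f" "f \<in> Hom C S X" using linked_is_mono[OF assms(3,4)] .
  then show ?thesis using fusion_subcategoryD(5)[OF assms(1)] assms(2) by blast
qed

text \<open>
  Every object is built from simple ones by biproducts, starting from a zero object, which is a
  subobject of the unit.
\<close>
lemma fusion_subcategory_eq_Obj:
  assumes D: "fusion_subcategory C D" and Irr: "Irr \<subseteq> D"
  shows "D = Obj C"
proof
  show "D \<subseteq> Obj C" using fusion_subcategoryD(1)[OF D] .
  have "X \<in> D" if "direct_sum C X Ss" "\<forall>S \<in> set Ss. simple_object C S" for X Ss
    using that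
  proof (induction rule: direct_sum.induct)
    case (Nil Z)
    then have Z: "Z \<in> Obj C" by (simp add: zero_object_def)
    have f: "Zero C Z (Unit C) \<in> Hom C Z (Unit C)" using Zero_in_Hom Z unit_obj by blast
    have "is_mono C (Zero C Z (Unit C))"
    proof (rule is_monoI[OF f])
      fix W g assume g: "g \<in> Hom C W Z"
      then show "g = Zero C W Z"
        using Nil.hyps Zero_in_Hom[of W Z] Hom_obj[OF g] unfolding zero_object_def by blast
    qed
    then show ?case using fusion_subcategoryD(2,5)[OF D] f by blast
  next
    case (Cons Z' Xs Z X)
    then have "simple_object C X" by simp
    then have "X \<in> D"
      using fusion_subcategory_constituent[OF D _ \<open>simple_object C X\<close> simple_rep(2)]
        simple_rep(3)[of X] Irr by blast
    moreover have "Z' \<in> D" using Cons.IH Cons.prems by simp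
    ultimately show ?case using fusion_subcategoryD(4)[OF D _ _ Cons.hyps(2)] by blast
  qed
  then show "Obj C \<subseteq> D" using semisimple subsetI[of "Obj C" D] by metis
qed

text \<open>
  Components of a grading are closed under kernels, and \<open>S\<close>, being a direct summand of \<open>X\<close>
  with inclusion \<open>i\<close> and projection \<open>p\<close>, is the kernel of \<open>1 - i p\<close>.
\<close>
lemma grading_constituent:
  assumes E: "grading C G E" and g: "g \<in> carrier G" and X: "X \<in> E g"
    and S: "simple_object C S" "linked C S X"
  shows "S \<in> E g"
proof -
  obtain i where i: "i \<in> Hom C S X" "i \<noteq> Zero C S X" using S(2) by (auto simp: linked_def)
  obtain p where p: "p \<in> Hom C X S" "p \<cdot> i = Id C S" using simple_subobject_splits[OF S(1) i] .
  have XO: "X \<in> Obj C" and SO: "S \<in> Obj C" using Hom_obj i by blast+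
  have ip: "i \<cdot> p \<in> Hom C X X" using comp_hom p i by blast
  define f where "f = Add C (Id C X) (Neg (i \<cdot> p))"
  have f: "f \<in> Hom C X X" using Add_in_Hom[OF id_hom[OF XO] Neg_in_Hom[OF ip]] by (simp add: f_def)
  have comp_f: "f \<cdot> h = Add C h (Neg (i \<cdot> (p \<cdot> h)))" if h: "h \<in> Hom C W X" for h W
    using comp_add_left[OF h id_hom[OF XO] Neg_in_Hom[OF ip]] comp_smult_left[OF h ip]
      comp_id_left[OF h] comp_assoc[OF h p(1) i(1)] by (simp add: f_def Neg_def)
  have "is_kernel C f i"
    unfolding is_kernel_def
  proof (intro conjI allI ballI impI)
    show "f \<in> Arr C" "i \<in> Arr C" "Cod C i = Dom C f" using f i by (auto simp: Hom_def)
    have fi: "Dom C f = X" "Cod C f = X" "Dom C i = S" using f i by (auto simp: Hom_def)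
    show "f \<cdot> i = Zero C (Dom C i) (Cod C f)"
      unfolding fi using comp_f[OF i(1)] p(2) comp_id_right[OF i(1)] Add_Neg[OF i(1)] by simp
    fix W h assume "h \<in> Hom C W (Dom C f)" "f \<cdot> h = Zero C W (Cod C f)"
    then have h: "h \<in> Hom C W X" "f \<cdot> h = Zero C W X" unfolding fi .
    then have eq: "i \<cdot> (p \<cdot> h) = h"
      using comp_f[OF h(1)] Add_Neg_eq_Zero[OF h(1) comp_hom[OF comp_hom[OF h(1) p(1)] i(1)]] by simp
    have "k = p \<cdot> h" if "k \<in> Hom C W S" "i \<cdot> k = h" for k
      using comp_assoc[OF that(1) i(1) p(1)] p(2) comp_id_left[OF that(1)] that(2) by simp
    then show "\<exists>!k. k \<in> Hom C W (Dom C i) \<and> i \<cdot> k = h"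
      unfolding fi using eq comp_hom[OF h(1) p(1)] by blast
  qed
  moreover have "Dom C f = X" "Cod C f = X" "Dom C i = S" using f i by (auto simp: Hom_def)
  moreover have "full_abelian_subcategory C (E g)" using E g by (simp add: grading_def)
  ultimately show ?thesis using X unfolding full_abelian_subcategory_def by metis
qed

lemma grading_simple_component:
  assumes E: "grading C G E" and S: "simple_object C S"
  obtains g where "g \<in> carrier G" "S \<in> E g"
proof -
  have SO: "S \<in> Obj C" using S by (simp add: simple_object_def)
  then have "S \<in> component_sum C E (carrier G)" using E by (simp add: grading_def)
  then obtain gs Xs where gs: "set gs \<subseteq> carrier G" "list_all2 (\<lambda>g Y. Y \<in> E g) gs Xs" "direct_sum C S Xs"
    by (auto simp: component_sum_def)
  obtain Y i p where Y: "Y \<in> set Xs" "i \<in> Hom C Y S" "Id C S \<cdot> i \<noteq> Zero C Y S"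
    using direct_sum_nonzero_summand[OF gs(3) id_hom[OF SO]] simple_object_Id[OF S] by metis
  have "linked C S Y" using Y comp_id_left[OF Y(2)] linked_sym by (auto simp: linked_def)
  moreover obtain g where "g \<in> set gs" "Y \<in> E g"
    using gs(2) Y(1) by (metis list_all2_conv_all_nth in_set_conv_nth)
  ultimately show ?thesis using that grading_constituent[OF E _ _ S] gs(1) by blast
qed

end

section \<open>The hypergroup of a braided fusion category\<close>

context braided_fusion_category
begin

lemma linked_braid:
  assumes "X \<in> Obj C" "Y \<in> Obj C"
  shows "linked C Z (X \<boxtimes> Y) \<longleftrightarrow> linked C Z (Y \<boxtimes> X)"
  using linked_comp_iso_left[OF braid_iso braid_hom] assms by blast

lemma linked_tensor_iff_right:
  assumes "X \<in> Obj C" "Y \<in> Obj C" "Z \<in> Obj C"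
  shows "linked C Z (X \<boxtimes> Y) \<longleftrightarrow> (\<exists>Q \<in> Irr. linked C Q Y \<and> linked C Z (X \<boxtimes> Q))"
  unfolding linked_braid[OF assms(1,2)] linked_tensor_iff[OF assms(2,1,3)]
  using linked_braid[OF assms(1)] Irr_obj by blast

text \<open>
  Frobenius reciprocity makes \<open>S\<close> a common constituent of \<open>X \<otimes> Y\<^sup>*\<close> and \<open>Z \<otimes> W\<^sup>*\<close>, and moving
  the duals back to the opposite sides is possible because of commutativity.  This gives the transposition
  axiom with arbitrary duals, rather than simple ones, in the intermediate steps.
\<close>
lemma linked_tensor_transposition:
  assumes S: "simple_object C S"
    and obj: "X \<in> Obj C" "Y \<in> Obj C" "Z \<in> Obj C" "W \<in> Obj C"
    and X: "linked C X (S \<boxtimes> Y)" and Z: "linked C Z (S \<boxtimes> W)"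
  shows "linked C (X \<boxtimes> W) (Z \<boxtimes> Y)"
proof -
  obtain Y' W' where Y': "left_dual C Y Y'" and W': "left_dual C W W'"
    using ex_left_dual[OF obj(2)] ex_left_dual[OF obj(4)] by blast
  have obj': "Y' \<in> Obj C" "W' \<in> Obj C" "S \<in> Obj C"
    using Y' W' S by (auto simp: left_dual_def simple_object_def)
  have XY: "X \<boxtimes> Y' \<in> Obj C" "W \<boxtimes> X \<in> Obj C" using tensor_obj obj obj' by auto
  have "linked C S (X \<boxtimes> Y')" using linked_transpose[OF Y' obj'(3) obj(1)] X by simp
  moreover have "linked C S (Z \<boxtimes> W')" using linked_transpose[OF W' obj'(3) obj(3)] Z by simp
  ultimately have "linked C (X \<boxtimes> Y') (Z \<boxtimes> W')" using linked_via_simple[OF S] by blast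
  then have "linked C Z ((X \<boxtimes> Y') \<boxtimes> W)" using linked_transpose[OF W' XY(1) obj(3)] by simp
  then have "linked C Z ((W \<boxtimes> X) \<boxtimes> Y')"
    using linked_braid[OF XY(1) obj(4)] linked_assoc[OF obj(4,1) obj'(1)] by simp
  then have "linked C (W \<boxtimes> X) (Z \<boxtimes> Y)" using linked_transpose[OF Y' obj(3) XY(2)] by simp
  then have "linked C (Z \<boxtimes> Y) (W \<boxtimes> X)" by (rule linked_sym)
  then have "linked C (Z \<boxtimes> Y) (X \<boxtimes> W)" using linked_braid[OF obj(4,1)] by simp
  then show ?thesis by (rule linked_sym)
qed

sublocale irr: finite_canonical_hypergroup Irr fusion_product "simple_rep (Unit C)"
proof
  let ?e = "simple_rep (Unit C)"
  show "finite Irr" using finite_Irr .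
  show e: "?e \<in> Irr" using simple_rep(3)[OF unit_simple] .
  show "S \<in> Irr" if "S \<in> fusion_product X Y" for S X Y
    using that by (simp add: fusion_product_iff)
  show "fusion_product X Y = fusion_product Y X" if "X \<in> Irr" "Y \<in> Irr" for X Y
    using linked_braid[OF Irr_obj[OF that(1)] Irr_obj[OF that(2)]] by (simp add: fusion_product_def)
  show "(\<Union>S \<in> fusion_product X Y. fusion_product S Z) = (\<Union>S \<in> fusion_product Y Z. fusion_product X S)"
    if "X \<in> Irr" "Y \<in> Irr" "Z \<in> Irr" for X Y Z
  proof -
    note obj = Irr_obj[OF that(1)] Irr_obj[OF that(2)] Irr_obj[OF that(3)]
    have "T \<in> (\<Union>S \<in> fusion_product X Y. fusion_product S Z) \<longleftrightarrow>
        T \<in> (\<Union>S \<in> fusion_product Y Z. fusion_product X S)" for T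
    proof (cases "T \<in> Irr")
      case True
      then have "T \<in> Obj C" by (rule Irr_obj)
      then have "(\<exists>S \<in> Irr. linked C S (X \<boxtimes> Y) \<and> linked C T (S \<boxtimes> Z)) \<longleftrightarrow>
          (\<exists>S \<in> Irr. linked C S (Y \<boxtimes> Z) \<and> linked C T (X \<boxtimes> S))"
        using linked_tensor_iff[of "X \<boxtimes> Y" Z T] linked_tensor_iff_right[of X "Y \<boxtimes> Z" T]
          linked_assoc[OF obj] tensor_obj obj by simp
      then show ?thesis using True by (auto simp: fusion_product_iff)
    qed (auto simp: fusion_product_iff)
    then show ?thesis by blast
  qed
  show "fusion_product ?e X = {X}" if X: "X \<in> Irr" for X
  proof -
    have XO: "X \<in> Obj C" using X by (rule Irr_obj)
    have eU: "linked C ?e (Unit C)" using simple_rep(2)[OF unit_simple] by (rule linked_sym)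
    have iff: "linked C S (?e \<boxtimes> X) \<longleftrightarrow> linked C S X" if S: "S \<in> Irr" for S
    proof -
      have "linked C S (Unit C \<boxtimes> X) \<longleftrightarrow> (\<exists>Q \<in> Irr. linked C Q (Unit C) \<and> linked C S (Q \<boxtimes> X))"
        using linked_tensor_iff[OF unit_obj XO Irr_obj[OF S]] .
      also have "\<dots> \<longleftrightarrow> linked C S (?e \<boxtimes> X)"
        using Irr_linked_simple_eq[OF _ unit_simple] e eU by blast
      finally show ?thesis using linked_Unit_tensor[OF XO] by simp
    qed
    have "S \<in> fusion_product ?e X \<longleftrightarrow> S = X" for S
    proof
      assume "S \<in> fusion_product ?e X"
      then have "S \<in> Irr" "linked C S X" using iff by (auto simp: fusion_product_iff)
      then show "S = X" using Irr_linked_eq[OF _ X] by blast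
    next
      assume "S = X"
      then show "S \<in> fusion_product ?e X"
        using iff[OF X] linked_refl_simple[OF Irr_simple[OF X]] X by (simp add: fusion_product_iff)
    qed
    then show ?thesis by blast
  qed
  show "\<exists>Y \<in> Irr. ?e \<in> fusion_product X Y" if X: "X \<in> Irr" for X
  proof -
    have XO: "X \<in> Obj C" using X by (rule Irr_obj)
    have eU: "linked C (Unit C) ?e" using simple_rep(2)[OF unit_simple] .
    obtain X' where X': "left_dual C X X'" using ex_left_dual[OF XO] by blast
    have XO': "X' \<in> Obj C" using X' by (simp add: left_dual_def)
    have "linked C X (Unit C \<boxtimes> X)"
      using linked_Unit_tensor[OF XO] linked_refl_simple[OF Irr_simple[OF X]] by simp
    then have "linked C (Unit C) (X \<boxtimes> X')" using linked_transpose[OF X' unit_obj XO] by simp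
    then have "linked C ?e (X \<boxtimes> X')" using linked_via_simple[OF unit_simple eU] by blast
    then obtain Q where "Q \<in> Irr" "linked C ?e (X \<boxtimes> Q)"
      using linked_tensor_iff_right[OF XO XO' Irr_obj[OF e]] by blast
    then show ?thesis using e by (auto simp: fusion_product_iff)
  qed
  show "fusion_product X W \<inter> fusion_product Z Y \<noteq> {}"
    if "S \<in> Irr" "X \<in> Irr" "Y \<in> Irr" "Z \<in> Irr" "W \<in> Irr"
      "X \<in> fusion_product S Y" "Z \<in> fusion_product S W" for S X Y Z W
  proof -
    have "linked C (X \<boxtimes> W) (Z \<boxtimes> Y)"
      using linked_tensor_transposition[of S X Y Z W] that Irr_obj Irr_simple by (simp add: fusion_product_iff)
    then obtain T where "T \<in> Irr" "linked C T (X \<boxtimes> W)" "linked C T (Z \<boxtimes> Y)"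
      using linked_Irr_constituent by blast
    then show ?thesis by (auto simp: fusion_product_iff)
  qed
qed

lemma closed_subset_fusion_subcategory:
  assumes D: "fusion_subcategory C D"
  shows "irr.closed_subset (D \<inter> Irr)"
  unfolding irr.closed_subset_def
proof (intro conjI ballI subsetI)
  show "S \<in> Irr" if "S \<in> D \<inter> Irr" for S using that by simp
  show "simple_rep (Unit C) \<in> D \<inter> Irr"
    using simple_rep[OF unit_simple] linked_sym
      fusion_subcategory_constituent[OF D fusion_subcategoryD(2)[OF D]] by simp
  show "T \<in> D \<inter> Irr" if "X \<in> D \<inter> Irr" "Y \<in> D \<inter> Irr" "T \<in> fusion_product X Y" for X Y T
  proof -
    have "T \<in> Irr" "linked C T (X \<boxtimes> Y)" using that(3) by (auto simp: fusion_product_iff)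
    moreover have "X \<boxtimes> Y \<in> D" using fusion_subcategoryD(3)[OF D] that by simp
    ultimately show ?thesis using fusion_subcategory_constituent[OF D] Irr_simple by simp
  qed
qed

text \<open>The inverse of the passage from a fusion subcategory to its set of simple objects.\<close>
definition objects_over :: "'o set \<Rightarrow> 'o set" where
  "objects_over K = {X \<in> Obj C. \<forall>S \<in> Irr. linked C S X \<longrightarrow> S \<in> K}"

lemma objects_over_Int_Irr: "S \<in> objects_over K \<Longrightarrow> S \<in> Irr \<Longrightarrow> S \<in> K"
  using linked_refl_simple Irr_simple by (simp add: objects_over_def)

lemma fusion_subcategory_objects_over:
  assumes K: "irr.closed_subset K"
  shows "fusion_subcategory C (objects_over K)"
proof (rule fusion_subcategoryI)
  show "objects_over K \<subseteq> Obj C" by (auto simp: objects_over_def)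
  show "Unit C \<in> objects_over K"
    using K unit_obj Irr_linked_simple_eq[OF _ unit_simple]
    by (auto simp: objects_over_def irr.closed_subset_def)
  show "X \<boxtimes> Y \<in> objects_over K" if "X \<in> objects_over K" "Y \<in> objects_over K" for X Y
  proof -
    have obj: "X \<in> Obj C" "Y \<in> Obj C" using that by (auto simp: objects_over_def)
    have "S \<in> K" if S: "S \<in> Irr" "linked C S (X \<boxtimes> Y)" for S
    proof -
      obtain Q where Q: "Q \<in> Irr" "linked C Q X" "linked C S (Q \<boxtimes> Y)"
        using linked_tensor_iff[OF obj Irr_obj[OF S(1)]] S(2) by blast
      obtain R where R: "R \<in> Irr" "linked C R Y" "linked C S (Q \<boxtimes> R)"
        using linked_tensor_iff_right[OF Irr_obj[OF Q(1)] obj(2) Irr_obj[OF S(1)]] Q(3) by blast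
      have "Q \<in> K" "R \<in> K"
        using \<open>X \<in> objects_over K\<close> \<open>Y \<in> objects_over K\<close> Q R by (auto simp: objects_over_def)
      moreover have "S \<in> fusion_product Q R" using S R by (simp add: fusion_product_iff)
      ultimately show ?thesis using K by (auto simp: irr.closed_subset_def)
    qed
    then show ?thesis using tensor_obj[OF obj] by (simp add: objects_over_def)
  qed
  show "Z \<in> objects_over K"
    if XY: "X \<in> objects_over K" "Y \<in> objects_over K" "biproduct C Z X Y" for X Y Z
  proof -
    obtain i j p q where h: "i \<in> Hom C X Z" "j \<in> Hom C Y Z" "p \<in> Hom C Z X" "q \<in> Hom C Z Y"
      "Add C (i \<cdot> p) (j \<cdot> q) = Id C Z"
      using XY(3) by (auto simp: biproduct_def)
    have "linked C S X \<or> linked C S Y" if "linked C S Z" for S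
    proof (rule ccontr)
      assume none: "\<not> ?thesis"
      obtain f where f: "f \<in> Hom C S Z" "f \<noteq> Zero C S Z" using \<open>linked C S Z\<close> by (auto simp: linked_def)
      have SO: "S \<in> Obj C" "Z \<in> Obj C" using Hom_obj f by blast+
      have "p \<cdot> f = Zero C S X" and "q \<cdot> f = Zero C S Y"
        using none comp_hom[OF f(1) h(3)] comp_hom[OF f(1) h(4)] unfolding linked_def by blast+
      then have "(i \<cdot> p) \<cdot> f = Zero C S Z" "(j \<cdot> q) \<cdot> f = Zero C S Z"
        using comp_assoc[OF f(1) h(3,1)] comp_assoc[OF f(1) h(4,2)]
          comp_Zero_right[OF h(1) SO(1)] comp_Zero_right[OF h(2) SO(1)] by simp_all
      then have "f = Zero C S Z"
        using comp_add_left[OF f(1) comp_hom[OF h(3,1)] comp_hom[OF h(4,2)]] h(5) comp_id_left[OF f(1)]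
          Add_Zero[OF Zero_in_Hom[OF SO]] by simp
      then show False using f(2) by simp
    qed
    moreover have "Z \<in> Obj C" using Hom_obj(2)[OF h(1)] .
    ultimately show ?thesis using XY(1,2) unfolding objects_over_def by blast
  qed
  show "X \<in> objects_over K" if f: "is_mono C f" "f \<in> Hom C X Y" and Y: "Y \<in> objects_over K" for f X Y
  proof -
    have "linked C S Y" if SX: "linked C S X" for S
    proof -
      obtain g where g: "g \<in> Hom C S X" "g \<noteq> Zero C S X" using SX by (auto simp: linked_def)
      then have "f \<cdot> g \<noteq> Zero C S Y" using is_mono_comp_Zero[OF f g(1)] by blast
      then show ?thesis using comp_hom[OF g(1) f(2)] by (auto simp: linked_def)
    qed
    then show ?thesis using Y Hom_obj(1)[OF f(2)] unfolding objects_over_def by blast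
  qed
qed

text \<open>
  By Frobenius reciprocity \<open>S\<close> occurs in \<open>X \<otimes> X\<^sup>*\<close> exactly if \<open>X\<close> occurs in \<open>S \<otimes> X\<close>, so
  the generators of the adjoint subcategory correspond to those of the adjoint of the hypergroup.
\<close>
lemma adjoint_subcategory_Int_Irr:
  assumes D: "fusion_subcategory C D"
  shows "fusion_subcategory C (adjoint_subcategory C D)"
    and "adjoint_subcategory C D \<inter> Irr = irr.adjoint (D \<inter> Irr)"
proof -
  let ?T = "{X \<boxtimes> Y |X Y. X \<in> D \<and> simple_object C X \<and> left_dual C X Y}"
  have "?T \<subseteq> Obj C" using tensor_obj by (auto simp: left_dual_def)
  then show A: "fusion_subcategory C (adjoint_subcategory C D)"
    unfolding adjoint_subcategory_def by (rule fusion_subcategory_generated)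
  have "?T \<subseteq> objects_over (irr.adjoint (D \<inter> Irr))"
  proof
    fix Z assume "Z \<in> ?T"
    then obtain X Y where Z: "Z = X \<boxtimes> Y" and X: "X \<in> D" "simple_object C X" and Y: "left_dual C X Y"
      by blast
    have obj: "X \<in> Obj C" "Y \<in> Obj C" using Y by (auto simp: left_dual_def)
    let ?R = "simple_rep X"
    note R = simple_rep[OF X(2)]
    have RX: "linked C ?R X" using linked_sym[OF R(2)] .
    have "S \<in> irr.adjoint (D \<inter> Irr)" if S: "S \<in> Irr" "linked C S (X \<boxtimes> Y)" for S
    proof -
      note SO = Irr_obj[OF S(1)]
      have "linked C X (S \<boxtimes> X)" using linked_transpose[OF Y SO obj(1)] S(2) by simp
      then have "linked C ?R (S \<boxtimes> X)" using linked_via_simple[OF X(2) R(2)] by blast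
      then obtain Q where Q: "Q \<in> Irr" "linked C Q X" "linked C ?R (S \<boxtimes> Q)"
        using linked_tensor_iff_right[OF SO obj(1) Irr_obj[OF R(3)]] by blast
      have "Q = ?R" using Irr_linked_simple_eq[OF Q(1) X(2) Q(2)] .
      then have "?R \<in> fusion_product S ?R" using Q R by (simp add: fusion_product_iff)
      moreover have "?R \<in> D \<inter> Irr"
        using fusion_subcategory_constituent[OF D X(1) R(1) RX] R(3) by simp
      ultimately have "S \<in> irr.adjoint_generators (D \<inter> Irr)"
        using S(1) unfolding irr.adjoint_generators_def by blast
      then show ?thesis using irr.adjoint_generators_subset_adjoint by blast
    qed
    then show "Z \<in> objects_over (irr.adjoint (D \<inter> Irr))"
      using tensor_obj[OF obj] by (simp add: Z objects_over_def)
  qed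
  then have "adjoint_subcategory C D \<subseteq> objects_over (irr.adjoint (D \<inter> Irr))"
    unfolding adjoint_subcategory_def
    by (rule generated_least[OF fusion_subcategory_objects_over[OF irr.closed_subset_adjoint]])
  moreover have "irr.adjoint (D \<inter> Irr) \<subseteq> adjoint_subcategory C D \<inter> Irr"
  proof (rule irr.adjoint_least[OF closed_subset_fusion_subcategory[OF A]], rule subsetI)
    fix S assume "S \<in> irr.adjoint_generators (D \<inter> Irr)"
    then obtain X where S: "S \<in> Irr" and X: "X \<in> D" "X \<in> Irr" "linked C X (S \<boxtimes> X)"
      by (auto simp: irr.adjoint_generators_def fusion_product_iff)
    have XO: "X \<in> Obj C" and SO: "S \<in> Obj C" using Irr_obj X S by auto
    obtain Y where Y: "left_dual C X Y" using ex_left_dual[OF XO] by blast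
    have "linked C S (X \<boxtimes> Y)" using linked_transpose[OF Y SO XO] X(3) by simp
    moreover have "X \<boxtimes> Y \<in> ?T" using X(1) Y Irr_simple[OF X(2)] by blast
    then have "X \<boxtimes> Y \<in> adjoint_subcategory C D"
      unfolding adjoint_subcategory_def by (rule subsetD[OF subset_generated])
    ultimately show "S \<in> adjoint_subcategory C D \<inter> Irr"
      using fusion_subcategory_constituent[OF A] Irr_simple[OF S] S by simp
  qed
  ultimately show "adjoint_subcategory C D \<inter> Irr = irr.adjoint (D \<inter> Irr)"
    using objects_over_Int_Irr by blast
qed

lemma iterated_adjoint_Int_Irr:
  "fusion_subcategory C (iterated_adjoint C n) \<and> iterated_adjoint C n \<inter> Irr = irr.adjoint_series n"
proof (induction n)
  case 0
  have "Irr \<subseteq> Obj C" using Irr_obj by blast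
  then show ?case using fusion_subcategory_Obj by (auto simp: irr.adjoint_series_0)
next
  case (Suc n)
  then show ?case
    using adjoint_subcategory_Int_Irr[of "iterated_adjoint C n"] by (simp add: irr.adjoint_series_Suc)
qed

lemma vec_subcategory_Int_Irr: "vec_subcategory C \<inter> Irr \<subseteq> {simple_rep (Unit C)}"
proof
  fix X assume "X \<in> vec_subcategory C \<inter> Irr"
  then obtain n where n: "direct_sum C X (replicate n (Unit C))" and X: "X \<in> Irr"
    by (auto simp: vec_subcategory_def)
  have XO: "X \<in> Obj C" "Id C X \<noteq> Zero C X X" using simple_object_Id[OF Irr_simple[OF X]] by auto
  obtain S i where "S \<in> set (replicate n (Unit C))" "i \<in> Hom C S X" "Id C X \<cdot> i \<noteq> Zero C S X"
    using direct_sum_nonzero_summand[OF n id_hom[OF XO(1)] XO(2)] by metis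
  then have "i \<in> Hom C (Unit C) X" "i \<noteq> Zero C (Unit C) X" using comp_id_left by auto
  then have "linked C X (Unit C)" using linked_sym by (auto simp: linked_def)
  then show "X \<in> {simple_rep (Unit C)}" using Irr_linked_simple_eq[OF X unit_simple] by simp
qed

lemma nilpotent_hypergroup_Irr:
  assumes "nilpotent_category C"
  shows "nilpotent_hypergroup Irr fusion_product (simple_rep (Unit C))"
proof
  obtain n where "iterated_adjoint C n = vec_subcategory C"
    using assms by (auto simp: nilpotent_category_def)
  then have "irr.adjoint_series n \<subseteq> {simple_rep (Unit C)}"
    using iterated_adjoint_Int_Irr[of n] vec_subcategory_Int_Irr by simp
  moreover have "simple_rep (Unit C) \<in> irr.adjoint_series n"
    using irr.closed_subset_adjoint_series[of n] by (simp add: irr.closed_subset_def)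
  ultimately show "\<exists>n. irr.adjoint_series n = {simple_rep (Unit C)}" by blast
qed

text \<open>
  The degrees in which \<open>D\<close> has a simple object form a subgroup, the inverses being supplied by
  closure under duals; it contains \<open>T\<close> and is therefore everything, so \<open>D\<close> has a simple object \<open>X\<close> in the degree of any given simple object \<open>S\<close>.
  A constituent \<open>Z\<close> of \<open>S \<otimes> X\<^sup>*\<close> has trivial degree, so it lies in \<open>C\<^sub>a\<^sub>d\<close>, and \<open>S\<close> occurs in
  \<open>X \<otimes> Z\<close>.  Thus \<open>D\<close> supplements \<open>C\<^sub>a\<^sub>d\<close>.
\<close>
theorem fusion_subcategory_meeting_components_eq_Obj:
  assumes nilpotent: "nilpotent_category C"
    and E: "grading C U E" and E1: "E \<one>\<^bsub>U\<^esub> = adjoint_subcategory C (Obj C)"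
    and D: "fusion_subcategory C D"
    and T: "T \<subseteq> carrier U" "carrier U \<subseteq> generate U T"
    and meets: "\<And>t. t \<in> T \<Longrightarrow> \<exists>X \<in> D \<inter> E t. simple_object C X"
  shows "D = Obj C"
proof (rule fusion_subcategory_eq_Obj[OF D])
  interpret N: nilpotent_hypergroup Irr fusion_product "simple_rep (Unit C)"
    using nilpotent_hypergroup_Irr[OF nilpotent] .
  interpret U: group U using E by (simp add: grading_def)
  let ?e = "simple_rep (Unit C)"
  let ?V = "{u \<in> carrier U. \<exists>X \<in> D \<inter> Irr. X \<in> E u}"
  have closed: "irr.closed_subset (D \<inter> Irr)" using closed_subset_fusion_subcategory[OF D] .
  have product: "Z \<in> E (u \<otimes>\<^bsub>U\<^esub> v)"
    if uv: "u \<in> carrier U" "v \<in> carrier U" "X \<in> E u" "Y \<in> E v" "Z \<in> fusion_product X Y" for u v X Y Z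
  proof -
    have "X \<boxtimes> Y \<in> E (u \<otimes>\<^bsub>U\<^esub> v)" using E uv(1-4) by (simp add: grading_def)
    then show ?thesis
      using grading_constituent[OF E U.m_closed[OF uv(1,2)]] uv(5) Irr_simple by (simp add: fusion_product_iff)
  qed
  have inverse: "\<exists>Y \<in> E (inv\<^bsub>U\<^esub> u). Y \<in> Irr \<and> ?e \<in> fusion_product X Y"
    if uX: "u \<in> carrier U" "X \<in> E u" "X \<in> Irr" for u X
  proof -
    have XO: "X \<in> Obj C" using Irr_obj uX(3) .
    obtain Y where Y: "Y \<in> Irr" "?e \<in> fusion_product X Y" using irr.inverse_exists[OF uX(3)] by blast
    obtain X' where X': "left_dual C X X'" using ex_left_dual[OF XO] by blast
    have XO': "X' \<in> Obj C" using X' by (simp add: left_dual_def)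
    have "{Y. \<exists>X \<in> E u. left_dual C X Y} = E (inv\<^bsub>U\<^esub> u)" using E uX(1) by (simp add: grading_def)
    then have X'E: "X' \<in> E (inv\<^bsub>U\<^esub> u)" using X' uX(2) by blast
    \<comment> \<open>transposing \<open>\<one> \<rightarrow> X \<otimes> Y\<close> gives \<open>Y \<rightarrow> X'\<close>\<close>
    have "linked C (Unit C) (X \<boxtimes> Y)"
      using linked_via_simple[OF simple_rep(1)[OF unit_simple] linked_sym[OF simple_rep(2)[OF unit_simple]]]
        Y(2) by (simp add: fusion_product_iff)
    then have "linked C (Unit C) (Y \<boxtimes> X)" using linked_braid[OF XO Irr_obj[OF Y(1)]] by simp
    then have "linked C Y (Unit C \<boxtimes> X')" using linked_transpose[OF X' Irr_obj[OF Y(1)] unit_obj] by simp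
    then have "linked C Y X'" using linked_Unit_tensor[OF XO'] by simp
    then have "Y \<in> E (inv\<^bsub>U\<^esub> u)"
      using grading_constituent[OF E U.inv_closed[OF uX(1)] X'E Irr_simple[OF Y(1)]] by simp
    then show ?thesis using Y by blast
  qed
  have TV: "t \<in> ?V" if tT: "t \<in> T" for t
  proof -
    have t: "t \<in> carrier U" using tT T by blast
    obtain X where X: "X \<in> D" "X \<in> E t" "simple_object C X" using meets[OF tT] by blast
    note R = simple_rep[OF X(3)]
    have RX: "linked C (simple_rep X) X" using linked_sym[OF R(2)] .
    have "simple_rep X \<in> D" using fusion_subcategory_constituent[OF D X(1) R(1) RX] .
    moreover have "simple_rep X \<in> E t" using grading_constituent[OF E t X(2) R(1) RX] .
    ultimately show ?thesis using R(3) t by blast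
  qed
  have V_inv: "inv\<^bsub>U\<^esub> u \<in> ?V" if uV: "u \<in> ?V" for u
  proof -
    obtain X where X: "u \<in> carrier U" "X \<in> D" "X \<in> Irr" "X \<in> E u" using uV by blast
    obtain Y where Y: "Y \<in> E (inv\<^bsub>U\<^esub> u)" "Y \<in> Irr" "?e \<in> fusion_product X Y"
      using inverse[OF X(1,4,3)] by blast
    have "Y \<in> D \<inter> Irr" using N.closed_subset_inverse[OF closed _ Y(2,3)] X by simp
    then show ?thesis using Y(1) U.inv_closed[OF X(1)] by blast
  qed
  have V_one: "\<one>\<^bsub>U\<^esub> \<in> ?V"
  proof -
    have "fusion_subcategory C (adjoint_subcategory C (Obj C))"
      using adjoint_subcategory_Int_Irr(1)[OF fusion_subcategory_Obj] .
    then have "?e \<in> E \<one>\<^bsub>U\<^esub>"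
      using closed_subset_fusion_subcategory unfolding E1 irr.closed_subset_def by blast
    then show ?thesis using closed unfolding irr.closed_subset_def by blast
  qed
  have V_mult: "u \<otimes>\<^bsub>U\<^esub> v \<in> ?V" if uV: "u \<in> ?V" "v \<in> ?V" for u v
  proof -
    obtain X Y where X: "u \<in> carrier U" "X \<in> D \<inter> Irr" "X \<in> E u"
      and Y: "v \<in> carrier U" "Y \<in> D \<inter> Irr" "Y \<in> E v"
      using uV by blast
    obtain Z where Z: "Z \<in> fusion_product X Y" using irr.mult_nonempty[of X Y] X Y by blast
    have "Z \<in> D \<inter> Irr" using closed X(2) Y(2) Z unfolding irr.closed_subset_def by blast
    then show ?thesis using product[OF X(1) Y(1) X(3) Y(3) Z] U.m_closed[OF X(1) Y(1)] by blast
  qed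
  have "u \<in> ?V" if "u \<in> generate U T" for u
    using that
  proof (induction rule: generate.induct)
    case one
    from V_one show ?case .
  next
    case (incl h)
    from TV[OF incl] show ?case .
  next
    case (inv h)
    from V_inv[OF TV[OF inv]] show ?case .
  next
    case (eng h1 h2)
    from V_mult[OF eng.IH] show ?case .
  qed
  then have V: "carrier U \<subseteq> ?V" using T(2) by blast
  have "\<exists>X \<in> D \<inter> Irr. \<exists>Z \<in> irr.adjoint_series 1. S \<in> fusion_product X Z" if S: "S \<in> Irr" for S
  proof -
    obtain u where u: "u \<in> carrier U" "S \<in> E u"
      using grading_simple_component[OF E Irr_simple[OF S]] .
    obtain X where X: "X \<in> D" "X \<in> Irr" "X \<in> E u" using subsetD[OF V u(1)] by blast
    obtain Y where Y: "Y \<in> E (inv\<^bsub>U\<^esub> u)" "Y \<in> Irr" "?e \<in> fusion_product X Y"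
      using inverse[OF u(1) X(3,2)] by blast
    obtain Z where Z: "Z \<in> fusion_product S Y" using irr.mult_nonempty[OF S Y(2)] by blast
    have ZI: "Z \<in> Irr" using irr.mult_closed[OF S Y(2) Z] .
    have "Z \<in> E (u \<otimes>\<^bsub>U\<^esub> inv\<^bsub>U\<^esub> u)"
      using product[OF u(1) U.inv_closed[OF u(1)] u(2) Y(1) Z] .
    then have "Z \<in> iterated_adjoint C (Suc 0) \<inter> Irr" using E1 u(1) ZI by simp
    then have "Z \<in> irr.adjoint_series 1" using iterated_adjoint_Int_Irr[of "Suc 0"] by (simp, blast)
    moreover have "?e \<in> fusion_product Y X" using Y(3) irr.mult_commute[OF X(2) Y(2)] by simp
    then have "S \<in> fusion_product Z X" using irr.reversibility[OF S Y(2) X(2) _ Z] by simp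
    then have "S \<in> fusion_product X Z" using irr.mult_commute[OF X(2) ZI] by simp
    ultimately show ?thesis using X(1,2) by blast
  qed
  then have "D \<inter> Irr = Irr" using N.closed_supplement_of_adjoint[OF closed] by blast
  then show "Irr \<subseteq> D" by blast
qed

end

theorem theorem4p7:
  fixes C :: "('o, 'm, 'k::{alg_closed_field, field_char_0}) braided_cat"
    and U :: "'u monoid"
    and E :: "'u \<Rightarrow> 'o set"
  assumes "braided_fusion_category C"
    and "nilpotent_category C"
    and "universal_grading C U E"
    and "cyclic_group U"
  shows "\<exists>X. simple_object C X \<and> generated_fusion_subcategory C {X} = Obj C"
proof -
  interpret braided_fusion_category C using assms(1) .
  have E: "grading C U E" and faithful: "\<And>u. u \<in> carrier U \<Longrightarrow> \<exists>X \<in> E u. \<not> zero_object C X"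
    and E1: "E \<one>\<^bsub>U\<^esub> = adjoint_subcategory C (Obj C)"
    using assms(3) by (auto simp: universal_grading_def faithful_grading_def)
  interpret U: group U using E by (simp add: grading_def)
  obtain g where g: "g \<in> carrier U" and "subgroup_generated U {g} = U"
    using assms(4) by (auto simp: cyclic_group_def)
  then have gen: "carrier U \<subseteq> generate U {g}"
    using carrier_subgroup_generated[of U "{g}"] g by simp
  obtain X where X: "X \<in> E g" "\<not> zero_object C X" using faithful[OF g] by blast
  have "E g \<subseteq> Obj C" using E g by (auto simp: grading_def full_abelian_subcategory_def)
  then have "X \<in> Obj C" using X(1) by blast
  then have "linked C X X" using zero_object_iff_Id X(2) id_hom unfolding linked_def by blast
  then obtain S where S: "simple_object C S" "linked C S X" using linked_simple_constituent by blast
  have SE: "S \<in> E g" using grading_constituent[OF E g X(1) S] .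
  have "fusion_subcategory C (generated_fusion_subcategory C {S})"
    using fusion_subcategory_generated S(1) by (simp add: simple_object_def)
  then have "generated_fusion_subcategory C {S} = Obj C"
    using fusion_subcategory_meeting_components_eq_Obj[OF assms(2) E E1 _ _ gen] g SE S(1)
      subset_generated[of "{S}"] by blast
  then show ?thesis using S(1) by blast
qed

end
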